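(* Let $f,g$ be non-negative integers and $\mu\in\mathcal P_{f,g}$. Then in $M^{(f,g)}$, \[t_\mu m=\sum_{\lambda\in\mathcal P_{f,g}}\mathrm i_{\lambda\mu}\,s_\lambda m.\]
   Context: $\mathbb F$ is any field, $k=f+g$, $\mathfrak S_k$ has Coxeter generators $t_i=(i\ i{+}1)$ and $s_i=t_i-1\in\mathbb F\mathfrak S_k$. $M^{(f,g)}=\langle m\mid t_im=m\ (i\ne f)\rangle$ as an $\mathbb F\mathfrak S_k$-module. $\mathcal P_{f,g}$ is the set of partitions with at most $g$ nonzero parts, all at most $f$. For $\lambda\in\mathcal P_{f,g}$, $t_\lambda=\prod_{r=1}^{g}(t_{\lambda_r+g-r+1}t_{\lambda_r+g-r+2}\cdots t_{f+g-r})$ with $r=1$ leftmost (a factor is empty if $\lambda_r=f$), and $s_\lambda$ is given by the same formula with each $t_i$ replaced by $s_i$. Partitions are identified with Young diagrams $\{(a,b)\in\mathbb N^2:b\le\lambda_a\}$; nodes are elements of $\mathbb N^2$; $(a,b)$ has height $a+b$ and lies in column $b-a$ (smaller column = further left). $\mathtt{NE}(\mathfrak n)=\mathfrak n+(0,1)$, $\mathtt{SE}(\mathfrak n)=\mathfrak n-(1,0)$, $\mathtt N(\mathfrak n)=\mathfrak n+(1,1)$. A tile is a finite nonempty set of nodes orderable $\mathfrak n_1,\dots,\mathfrak n_r$ with $\mathfrak n_{i+1}\in\{\mathtt{NE}(\mathfrak n_i),\mathtt{SE}(\mathfrak n_i)\}$; start = leftmost node, end = rightmost node; Dyck tile if start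 and end both attain the maximal height of its nodes. A Dyck tiling of $\lambda\setminus\mu$ ($\lambda\supseteq\mu$) is a partition of it into Dyck tiles; it is cover-inclusive if whenever $\mathfrak a,\mathtt N(\mathfrak a)\in\lambda\setminus\mu$, the tile of $\mathtt N(\mathfrak a)$ starts weakly left of and ends weakly right of the tile of $\mathfrak a$. $\mathrm i_{\lambda\mu}$ is the number of cover-inclusive Dyck tilings of $\lambda\setminus\mu$ if $\lambda\supseteq\mu$, and $0$ otherwise. *)

theory Defs
  imports "HOL-Combinatorics.Permutations"
begin

definition perms :: "nat \<Rightarrow> (nat \<Rightarrow> nat) set" where
  "perms k = {\<sigma>. \<sigma> permutes {1..k}}"

definition galg :: "nat \<Rightarrow> ((nat \<Rightarrow> nat) \<Rightarrow> 'a::field) set" where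
  "galg k = {x. \<forall>\<sigma>. x \<sigma> \<noteq> 0 \<longrightarrow> \<sigma> \<in> perms k}"

definition delta :: "(nat \<Rightarrow> nat) \<Rightarrow> (nat \<Rightarrow> nat) \<Rightarrow> 'a::field" where
  "delta \<sigma> = (\<lambda>\<tau>. if \<tau> = \<sigma> then 1 else 0)"

definition gmult :: "nat \<Rightarrow> ((nat \<Rightarrow> nat) \<Rightarrow> 'a::field) \<Rightarrow> ((nat \<Rightarrow> nat) \<Rightarrow> 'a) \<Rightarrow> ((nat \<Rightarrow> nat) \<Rightarrow> 'a)" where
  "gmult k x y = (\<lambda>\<sigma>. \<Sum>\<tau>\<in>perms k. \<Sum>\<rho>\<in>perms k. if \<tau> \<circ> \<rho> = \<sigma> then x \<tau> * y \<rho> else 0)"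

fun gprod :: "nat \<Rightarrow> ((nat \<Rightarrow> nat) \<Rightarrow> 'a::field) list \<Rightarrow> ((nat \<Rightarrow> nat) \<Rightarrow> 'a)" where
  "gprod k [] = delta id"
| "gprod k (x # xs) = gmult k x (gprod k xs)"

definition tgen :: "nat \<Rightarrow> (nat \<Rightarrow> nat) \<Rightarrow> 'a::field" where
  "tgen i = delta (transpose i (Suc i))"

definition sgen :: "nat \<Rightarrow> (nat \<Rightarrow> nat) \<Rightarrow> 'a::field" where
  "sgen i = (\<lambda>\<sigma>. tgen i \<sigma> - delta id \<sigma>)"

text \<open>M^(f,g) is the cyclic F S_k-module generated by m subject to t_i m = m for
i \<noteq> f (1 \<le> i \<le> k-1).  Hence x m = y m in M^(f,g) iff x - y lies in the left
ideal of F S_k generated by the elements t_i - 1 = s_i with 1 \<le> i < k, i \<noteq> f.\<close>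

definition M_eq :: "nat \<Rightarrow> nat \<Rightarrow> ((nat \<Rightarrow> nat) \<Rightarrow> 'a::field) \<Rightarrow> ((nat \<Rightarrow> nat) \<Rightarrow> 'a) \<Rightarrow> bool" where
  "M_eq f g x y \<longleftrightarrow>
     (\<exists>c :: nat \<Rightarrow> ((nat \<Rightarrow> nat) \<Rightarrow> 'a). (\<forall>i. c i \<in> galg (f + g)) \<and>
        (\<lambda>\<sigma>. x \<sigma> - y \<sigma>) =
        (\<lambda>\<sigma>. \<Sum>i\<in>{1..<f+g} - {f}. gmult (f + g) (c i) (sgen i) \<sigma>))"

text \<open>A partition with at most g nonzero parts is represented by the list
[lam_1, ..., lam_g] of its first g parts (padded with zeros).\<close>

definition part :: "nat list \<Rightarrow> nat \<Rightarrow> nat" where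
  "part lam r = (if 1 \<le> r \<and> r \<le> length lam then lam ! (r - 1) else 0)"

definition Pfg :: "nat \<Rightarrow> nat \<Rightarrow> nat list set" where
  "Pfg f g = {lam. length lam = g \<and> sorted_wrt (\<ge>) lam \<and> (\<forall>x\<in>set lam. x \<le> f)}"

definition word :: "nat \<Rightarrow> nat \<Rightarrow> nat list \<Rightarrow> nat list" where
  "word f g lam = concat (map (\<lambda>r. [part lam r + g - r + 1 ..< f + g - r + 1]) [1..<g+1])"

definition t_part :: "nat \<Rightarrow> nat \<Rightarrow> nat list \<Rightarrow> (nat \<Rightarrow> nat) \<Rightarrow> 'a::field" where
  "t_part f g lam = gprod (f + g) (map tgen (word f g lam))"

definition s_part :: "nat \<Rightarrow> nat \<Rightarrow> nat list \<Rightarrow> (nat \<Rightarrow> nat) \<Rightarrow> 'a::field" where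
  "s_part f g lam = gprod (f + g) (map sgen (word f g lam))"

type_synonym node = "int \<times> int"

definition diagram :: "nat list \<Rightarrow> node set" where
  "diagram lam = {(a, b). 1 \<le> a \<and> 1 \<le> b \<and> b \<le> int (part lam (nat a))}"

definition height :: "node \<Rightarrow> int" where "height n = fst n + snd n"
definition column :: "node \<Rightarrow> int" where "column n = snd n - fst n"
definition NE :: "node \<Rightarrow> node" where "NE n = (fst n, snd n + 1)"
definition SE :: "node \<Rightarrow> node" where "SE n = (fst n - 1, snd n)"
definition Nn :: "node \<Rightarrow> node" where "Nn n = (fst n + 1, snd n + 1)"

definition tile :: "node set \<Rightarrow> bool" where
  "tile T \<longleftrightarrow> (\<exists>ns. ns \<noteq> [] \<and> distinct ns \<and> set ns = T \<and>
     (\<forall>i. Suc i < length ns \<longrightarrow> ns ! Suc i \<in> {NE (ns ! i), SE (ns ! i)}))"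

definition start_col :: "node set \<Rightarrow> int" where "start_col T = Min (column ` T)"
definition end_col :: "node set \<Rightarrow> int" where "end_col T = Max (column ` T)"

definition dyck_tile :: "node set \<Rightarrow> bool" where
  "dyck_tile T \<longleftrightarrow> tile T \<and>
     (\<forall>n\<in>T. column n = start_col T \<longrightarrow> height n = Max (height ` T)) \<and>
     (\<forall>n\<in>T. column n = end_col T \<longrightarrow> height n = Max (height ` T))"

definition dyck_tiling :: "node set \<Rightarrow> node set set \<Rightarrow> bool" where
  "dyck_tiling D \<T> \<longleftrightarrow> (\<forall>T\<in>\<T>. dyck_tile T) \<and> \<Union>\<T> = D \<and>
     (\<forall>T1\<in>\<T>. \<forall>T2\<in>\<T>. T1 \<noteq> T2 \<longrightarrow> T1 \<inter> T2 = {})"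

definition cover_inclusive :: "node set \<Rightarrow> node set set \<Rightarrow> bool" where
  "cover_inclusive D \<T> \<longleftrightarrow> (\<forall>a. a \<in> D \<and> Nn a \<in> D \<longrightarrow>
     (\<forall>T\<in>\<T>. \<forall>T'\<in>\<T>. a \<in> T \<and> Nn a \<in> T' \<longrightarrow>
        start_col T' \<le> start_col T \<and> end_col T \<le> end_col T'))"

definition ici :: "nat list \<Rightarrow> nat list \<Rightarrow> nat" where
  "ici lam mu = (if diagram mu \<subseteq> diagram lam
     then card {\<T>. dyck_tiling (diagram lam - diagram mu) \<T> \<and>
                   cover_inclusive (diagram lam - diagram mu) \<T>}
     else 0)"

end

theory Submission
  imports Defs
begin

text \<open>\<open>M\<close> is the permutation module on words \<open>w\<close> with \<open>f\<close> letters \<open>False\<close> and \<open>g\<close> letters \<open>True\<close>, and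
  \<open>m\<close> is the sorted word.  The boundary path of a partition is such a word; \<open>t\<^sub>\<mu> m\<close> is the basis vector
  of the path of \<open>\<mu>\<close>, and \<open>s\<^sub>\<lambda> m\<close> is its cup diagram: delete some factor \<open>TF\<close> of the path, expand
  the rest, and insert \<open>TF - FT\<close> at the same place.  From \<open>v\<^sub>1 TF v\<^sub>2 = v\<^sub>1 FT v\<^sub>2 + v\<^sub>1 (TF - FT) v\<^sub>2\<close> the
  coefficients \<open>i(u, v)\<close> of the expansion of words in cup diagrams satisfy
  \<open>i(u, v\<^sub>1 TF v\<^sub>2) = i(u, v\<^sub>1 FT v\<^sub>2) + [u = u\<^sub>1 TF u\<^sub>2] i(u\<^sub>1 u\<^sub>2, v\<^sub>1 v\<^sub>2)\<close> where \<open>u\<^sub>1\<close> and \<open>v\<^sub>1\<close> have the same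
  length.  Cover-inclusive Dyck tilings obey the same recursion: \<open>TF\<close> is an addable node of \<open>\<mu>\<close>; either
  that node is a singleton tile, which may be removed, or every tile meeting its column has a valley
  there, and the column can be collapsed together with its two neighbours.\<close>

section \<open>Dyck tiles as lattice paths\<close>

text \<open>The condition on \<open>u\<close> in the recursion has a geometric source.
  Cover-inclusiveness makes tiles widen going up a column, so a tile through the addable node other
  than the singleton forces a valley on everything above it, up to the topmost node of the column.
  Hence the upper path has a factor TF there too. On the algebraic side the factor TF of
  \<open>v\<close> is fixed while \<open>u\<close> ranges over all words, so a cup diagram must be
  expandable at a prescribed factor TF, not only at the one used in its definition. Distinct factors
  TF of a word are disjoint and cups at disjoint places commute, so the order of deletion is
  immaterial. That s_lambda m is a cup diagram then rests on two zigzag relations: s_i turns a cup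
  at an adjacent position into a cup at its own position. Equality in M may be tested on words
  because two permutations with the same word differ on the right by an element of S_f x S_g, and
  this subgroup is generated by the t_i with i different from f.\<close>

definition strip :: "(int \<Rightarrow> int) \<Rightarrow> int \<Rightarrow> int \<Rightarrow> node set" where
  "strip h s e = (\<lambda>c. (h c, c + h c)) ` {s..e}"

text \<open>NE and SE both raise the column by one, so a tile is the graph of a function of the
  column, with \<open>h c\<close> the first coordinate. NE keeps \<open>h\<close>, SE lowers it by
  one, and the height of the node is 2 * h c + c.\<close>

definition dyck_path :: "(int \<Rightarrow> int) \<Rightarrow> int \<Rightarrow> int \<Rightarrow> bool" where
  "dyck_path h s e \<longleftrightarrow> s \<le> e \<and>
     (\<forall>c. s \<le> c \<and> c < e \<longrightarrow> h (c + 1) = h c \<or> h (c + 1) = h c - 1) \<and>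
     (\<forall>c. s \<le> c \<and> c \<le> e \<longrightarrow> 2 * h c + c \<le> 2 * h s + s) \<and>
     2 * h e + e = 2 * h s + s"

lemma dyck_path_step:
  "dyck_path h s e \<Longrightarrow> s \<le> c \<Longrightarrow> c < e \<Longrightarrow> h (c + 1) = h c \<or> h (c + 1) = h c - 1"
  and dyck_path_le: "dyck_path h s e \<Longrightarrow> s \<le> c \<Longrightarrow> c \<le> e \<Longrightarrow> 2 * h c + c \<le> 2 * h s + s"
  and dyck_path_ends: "dyck_path h s e \<Longrightarrow> 2 * h e + e = 2 * h s + s" "dyck_path h s e \<Longrightarrow> s \<le> e"
  by (simp_all add: dyck_path_def)

lemma mem_strip: "(a, b) \<in> strip h s e \<longleftrightarrow> s \<le> b - a \<and> b - a \<le> e \<and> a = h (b - a)"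
  by (force simp: strip_def)

lemma mem_strip_col: "(a, a + c) \<in> strip h s e \<longleftrightarrow> s \<le> c \<and> c \<le> e \<and> a = h c"
  by (simp add: mem_strip)

lemma start_col_strip: "s \<le> e \<Longrightarrow> start_col (strip h s e) = s"
  and end_col_strip: "s \<le> e \<Longrightarrow> end_col (strip h s e) = e"
  by (simp_all add: start_col_def end_col_def strip_def column_def image_image
      Min_eq_iff Max_eq_iff)

lemma dyck_tile_strip:
  assumes "s \<le> e"
  shows "(\<forall>n\<in>strip h s e. column n = start_col (strip h s e) \<longrightarrow>
            height n = Max (height ` strip h s e)) \<and>
         (\<forall>n\<in>strip h s e. column n = end_col (strip h s e) \<longrightarrow>
            height n = Max (height ` strip h s e)) \<longleftrightarrow>
         (\<forall>c. s \<le> c \<and> c \<le> e \<longrightarrow> 2 * h c + c \<le> 2 * h s + s) \<and>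
         2 * h e + e = 2 * h s + s" (is "?L \<longleftrightarrow> ?R")
proof -
  let ?M = "Max (height ` strip h s e)"
  have hts: "height ` strip h s e = (\<lambda>c. 2 * h c + c) ` {s..e}"
    by (auto simp: strip_def height_def image_image)
  have "?L \<longleftrightarrow> 2 * h s + s = ?M \<and> 2 * h e + e = ?M"
    unfolding start_col_strip[OF assms] end_col_strip[OF assms]
    using assms by (auto simp: strip_def column_def height_def)
  also have "\<dots> \<longleftrightarrow> ?R"
    unfolding hts
  proof
    assume "2 * h s + s = Max ((\<lambda>c. 2 * h c + c) ` {s..e}) \<and>
      2 * h e + e = Max ((\<lambda>c. 2 * h c + c) ` {s..e})"
    then show ?R by (auto intro!: Max_ge)
  next
    assume ?R
    then have "Max ((\<lambda>c. 2 * h c + c) ` {s..e}) = 2 * h s + s"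
      using assms by (intro Max_eqI) auto
    with \<open>?R\<close> show "2 * h s + s = Max ((\<lambda>c. 2 * h c + c) ` {s..e}) \<and>
      2 * h e + e = Max ((\<lambda>c. 2 * h c + c) ` {s..e})" by simp
  qed
  finally show ?thesis .
qed

lemma tile_strip:
  assumes "s \<le> e" "\<And>c. s \<le> c \<Longrightarrow> c < e \<Longrightarrow> h (c + 1) = h c \<or> h (c + 1) = h c - 1"
  shows "tile (strip h s e)"
proof -
  let ?ns = "map (\<lambda>c. (h c, c + h c)) [s..e]"
  have "distinct ?ns"
    by (auto simp: distinct_map inj_on_def)
  moreover have "?ns ! Suc i \<in> {NE (?ns ! i), SE (?ns ! i)}" if "Suc i < length ?ns" for i
    using that assms(2)[of "s + int i"] by (auto simp: NE_def SE_def algebra_simps)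
  ultimately show ?thesis
    unfolding tile_def strip_def using assms(1) by (intro exI[of _ ?ns]) auto
qed

lemma tileE:
  assumes "tile T"
  obtains h s e where "s \<le> e" "T = strip h s e"
    "\<And>c. s \<le> c \<Longrightarrow> c < e \<Longrightarrow> h (c + 1) = h c \<or> h (c + 1) = h c - 1"
proof -
  from assms obtain ns where ns: "ns \<noteq> []" "set ns = T"
    and step: "\<And>i. Suc i < length ns \<Longrightarrow> ns ! Suc i \<in> {NE (ns ! i), SE (ns ! i)}"
    unfolding tile_def by blast
  define s where "s = column (ns ! 0)"
  \<comment> \<open>Every step advances one column, so the node in column c has list index c -
    s.\<close>
  define h where "h c = fst (ns ! nat (c - s))" for c
  have col: "column (ns ! i) = s + int i" if "i < length ns" for i
    using that
  proof (induction i)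
    case (Suc i)
    then show ?case using step[of i] by (auto simp: column_def NE_def SE_def)
  qed (simp add: s_def)
  have nth: "ns ! i = (h (s + int i), s + int i + h (s + int i))" if "i < length ns" for i
    using col[OF that] by (simp add: h_def column_def prod_eq_iff)
  let ?e = "s + int (length ns) - 1"
  have "T = strip h s ?e"
  proof (intro set_eqI iffI)
    fix n assume "n \<in> T"
    then obtain i where "i < length ns" "n = ns ! i" using ns by (metis in_set_conv_nth)
    then show "n \<in> strip h s ?e" unfolding strip_def
      by (intro image_eqI[of _ _ "s + int i"]) (simp_all add: nth)
  next
    fix n assume "n \<in> strip h s ?e"
    then obtain c where c: "s \<le> c" "c \<le> ?e" "n = (h c, c + h c)" by (auto simp: strip_def)
    then have "nat (c - s) < length ns" by linarith
    with c nth[of "nat (c - s)"] ns show "n \<in> T" by (metis add_diff_cancel_left' add_diff_eq diff_ge_0_iff_ge int_nat_eq nth_mem)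
  qed
  moreover have "h (c + 1) = h c \<or> h (c + 1) = h c - 1" if "s \<le> c" "c < ?e" for c
  proof -
    define i where "i = nat (c - s)"
    have i: "Suc i < length ns" "c = s + int i" using that by (auto simp: i_def)
    have "nat (c + 1 - s) = Suc i" using i by simp
    then show ?thesis using step[OF i(1)] by (auto simp: h_def i_def NE_def SE_def)
  qed
  moreover have "s \<le> ?e" using ns by (cases ns) auto
  ultimately show thesis using that by blast
qed

lemma dyck_tile_iff: "dyck_tile T \<longleftrightarrow> (\<exists>h s e. dyck_path h s e \<and> T = strip h s e)"
proof
  assume T: "dyck_tile T"
  then obtain h s e where "s \<le> e" "T = strip h s e"
    "\<And>c. s \<le> c \<Longrightarrow> c < e \<Longrightarrow> h (c + 1) = h c \<or> h (c + 1) = h c - 1"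
    unfolding dyck_tile_def using tileE by metis
  with T show "\<exists>h s e. dyck_path h s e \<and> T = strip h s e"
    unfolding dyck_tile_def dyck_path_def using dyck_tile_strip[of s e h] by blast
next
  assume "\<exists>h s e. dyck_path h s e \<and> T = strip h s e"
  then obtain h s e where d: "dyck_path h s e" and T: "T = strip h s e" by blast
  then have "s \<le> e" by (simp add: dyck_path_def)
  moreover have "tile (strip h s e)" using d by (intro tile_strip) (auto simp: dyck_path_def)
  ultimately show "dyck_tile T"
    using d dyck_tile_strip[of s e h] unfolding dyck_tile_def dyck_path_def T by blast
qed

section \<open>Cover-inclusive Dyck tilings of the region between two paths\<close>

definition ci_tilings :: "node set \<Rightarrow> node set set set" where
  "ci_tilings D = {\<T>. dyck_tiling D \<T> \<and> cover_inclusive D \<T>}"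

lemma ci_tilings_strip:
  assumes "\<T> \<in> ci_tilings D" "T \<in> \<T>"
  obtains h s e where "dyck_path h s e" "T = strip h s e" "start_col T = s" "end_col T = e"
proof -
  obtain h s e where "dyck_path h s e" "T = strip h s e"
    using assms by (auto simp: ci_tilings_def dyck_tiling_def dyck_tile_iff)
  with that show thesis
    using start_col_strip end_col_strip unfolding dyck_path_def by metis
qed

lemma ci_tilings_subset: "\<T> \<in> ci_tilings D \<Longrightarrow> T \<in> \<T> \<Longrightarrow> T \<subseteq> D"
  by (auto simp: ci_tilings_def dyck_tiling_def)

lemma ci_tilings_unique:
  "\<T> \<in> ci_tilings D \<Longrightarrow> T \<in> \<T> \<Longrightarrow> T' \<in> \<T> \<Longrightarrow> x \<in> T \<Longrightarrow> x \<in> T' \<Longrightarrow> T = T'"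
  unfolding ci_tilings_def dyck_tiling_def by blast

lemma ci_tilings_obtain:
  assumes "\<T> \<in> ci_tilings D" "x \<in> D"
  obtains T where "T \<in> \<T>" "x \<in> T"
  using assms by (auto simp: ci_tilings_def dyck_tiling_def)

lemma ci_tilings_cover:
  assumes "\<T> \<in> ci_tilings D" "T \<in> \<T>" "T' \<in> \<T>" "a \<in> T" "Nn a \<in> T'"
  shows "start_col T' \<le> start_col T" "end_col T \<le> end_col T'"
proof -
  have "a \<in> D" "Nn a \<in> D" using assms ci_tilings_subset by blast+
  then have "start_col T' \<le> start_col T \<and> end_col T \<le> end_col T'"
    using assms unfolding ci_tilings_def cover_inclusive_def by blast
  then show "start_col T' \<le> start_col T" "end_col T \<le> end_col T'" by simp_all
qed

lemma ci_tilings_empty: "ci_tilings {} = {{}}"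
proof -
  have "\<T> = {}" if "dyck_tiling {} \<T>" for \<T>
    using that by (auto simp: dyck_tiling_def dyck_tile_def tile_def)
  then show ?thesis
    by (auto simp: ci_tilings_def cover_inclusive_def) (simp add: dyck_tiling_def)
qed

lemma finite_ci_tilings:
  assumes "finite D"
  shows "finite (ci_tilings D)"
proof (rule finite_subset)
  show "ci_tilings D \<subseteq> Pow (Pow D)"
    by (auto simp: ci_tilings_def dyck_tiling_def)
qed (use assms in simp)

definition region :: "(int \<Rightarrow> int) \<Rightarrow> (int \<Rightarrow> int) \<Rightarrow> node set" where
  "region A B = {(a, b). B (b - a) < a \<and> a \<le> A (b - a)}"

lemma mem_region_col: "(a, a + c) \<in> region A B \<longleftrightarrow> B c < a \<and> a \<le> A c"
  by (simp add: region_def)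

text \<open>Induction up the column: the tile of the next node is at least as wide as the present one and
  disjoint from it, so it has to follow its valley.\<close>

lemma ci_tilings_valley:
  assumes T: "\<T> \<in> ci_tilings (region A B)"
    and B: "B j = B (j + 1) + 1" "B (j + 2) = B (j + 1)"
    and n: "{(B (j + 1) + 1, B (j + 1) + 1 + (j + 1))} \<notin> \<T>"
    and mem: "T \<in> \<T>" "(a, a + (j + 1)) \<in> T"
  shows "(a + 1, a + 1 + j) \<in> T \<and> (a, a + (j + 2)) \<in> T"
proof -
  note sub = ci_tilings_subset[OF T] and disj = ci_tilings_unique[OF T]
  have "B (j + 1) + 1 \<le> a" using mem(2) sub[OF mem(1)] mem_region_col by fastforce
  then show ?thesis using mem
  proof (induction a arbitrary: T rule: int_ge_induct)
    case base
    obtain h s e where d: "dyck_path h s e" and Teq: "T = strip h s e"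
      using T base(1) by (rule ci_tilings_strip)
    have j: "s \<le> j + 1" "j + 1 \<le> e" "h (j + 1) = B (j + 1) + 1"
      using base(2) unfolding Teq mem_strip_col by simp_all
    \<comment> \<open>The node of T in column j lies strictly above B j = B (j + 1) + 1, so the step
      into column j + 1 must go down.\<close>
    have left: "h j = h (j + 1) + 1" if "s \<le> j"
    proof -
      have "h (j + 1) = h j \<or> h (j + 1) = h j - 1" using dyck_path_step[OF d, of j] j that by linarith
      moreover have "(h j, h j + j) \<in> T" using that j unfolding Teq mem_strip_col by simp
      then have "B j < h j" using sub[OF base(1)] mem_region_col by blast
      ultimately show ?thesis using j B by linarith
    qed
    have right: "h (j + 2) = h (j + 1)" if "j + 2 \<le> e"
    proof -
      have "h (j + 2) = h (j + 1) \<or> h (j + 2) = h (j + 1) - 1"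
        using dyck_path_step[OF d, of "j + 1"] j that by (simp add: add.assoc)
      moreover have "(h (j + 2), h (j + 2) + (j + 2)) \<in> T" using that j unfolding Teq mem_strip_col by simp
      then have "B (j + 2) < h (j + 2)" using sub[OF base(1)] mem_region_col by blast
      ultimately show ?thesis using j B by linarith
    qed
    have "\<not> (s = j + 1 \<and> e = j + 1)"
    proof
      assume "s = j + 1 \<and> e = j + 1"
      then have "T = {(B (j + 1) + 1, B (j + 1) + 1 + (j + 1))}"
        using j by (auto simp: Teq strip_def)
      with n base(1) show False by simp
    qed
    \<comment> \<open>If T started in column j + 1 and went on, \<open>right\<close> would take it
      above the height of its start, which is maximal. So T would end there too and be the excluded
      singleton; the other end is symmetric.\<close>
    moreover have "e = j + 1" if "s = j + 1"
    proof (rule ccontr)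
      assume "e \<noteq> j + 1"
      then have "2 * h (j + 2) + (j + 2) \<le> 2 * h s + s"
        using dyck_path_le[OF d, of "j + 2"] j that by linarith
      with right \<open>e \<noteq> j + 1\<close> j that show False by simp
    qed
    moreover have "s = j + 1" if "e = j + 1"
    proof (rule ccontr)
      assume "s \<noteq> j + 1"
      then have "2 * h j + j \<le> 2 * h e + e"
        using dyck_path_le[OF d, of j] dyck_path_ends[OF d] j that by linarith
      with left \<open>s \<noteq> j + 1\<close> j that show False by simp
    qed
    ultimately have "s \<le> j" "j + 2 \<le> e" using j by linarith+
    with left right j show ?case unfolding Teq mem_strip_col by simp
  next
    case (step a)
    have reg: "(a + 1, a + 1 + (j + 1)) \<in> region A B" using step.prems sub by blast
    then have "(a, a + (j + 1)) \<in> region A B" using step.hyps unfolding mem_region_col by simp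
    then obtain T0 where T0: "T0 \<in> \<T>" "(a, a + (j + 1)) \<in> T0"
      using T ci_tilings_obtain by blast
    note V = step.IH[OF T0]
    have "Nn (a, a + (j + 1)) \<in> T" using step.prems by (simp add: Nn_def algebra_simps)
    note ci_tilings_cover[OF T T0(1) step.prems(1) T0(2) this]
    moreover obtain h s e where d: "dyck_path h s e" and Teq: "T = strip h s e"
      and se: "start_col T = s" "end_col T = e"
      using T step.prems(1) by (rule ci_tilings_strip)
    moreover obtain h0 s0 e0 where T0eq: "T0 = strip h0 s0 e0"
      and se0: "start_col T0 = s0" "end_col T0 = e0"
      using T T0(1) by (rule ci_tilings_strip)
    moreover have "s0 \<le> j" "j + 2 \<le> e0" using V unfolding T0eq mem_strip_col by simp_all
    ultimately have sj: "s \<le> j" and ej: "j + 2 \<le> e" by simp_all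
    have hj: "h (j + 1) = a + 1" using step.prems unfolding Teq mem_strip_col by simp
    have notin: "(a + 1, a + 1 + (j + 1)) \<notin> T0" using T0(2) unfolding T0eq mem_strip_col by simp
    \<comment> \<open>By the induction hypothesis T0 already owns this node of column j. If T passed
      through it, T and T0 would coincide, but T0 meets column j + 1 only in the node below.\<close>
    have "h j \<noteq> a + 1"
    proof
      assume "h j = a + 1"
      then have "(a + 1, a + 1 + j) \<in> T" using sj ej unfolding Teq mem_strip_col by simp
      then have "T = T0" using disj step.prems(1) T0(1) V by blast
      with notin step.prems(2) show False by simp
    qed
    moreover have "h (j + 2) \<noteq> a"
    proof
      assume "h (j + 2) = a"
      then have "(a, a + (j + 2)) \<in> T" using sj ej unfolding Teq mem_strip_col by simp
      then have "T = T0" using disj step.prems(1) T0(1) V by blast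
      with notin step.prems(2) show False by simp
    qed
    moreover have "h (j + 1) = h j \<or> h (j + 1) = h j - 1"
      using dyck_path_step[OF d, of j] sj ej by linarith
    moreover have "h (j + 2) = h (j + 1) \<or> h (j + 2) = h (j + 1) - 1"
      using dyck_path_step[OF d, of "j + 1"] sj ej by (simp add: add.assoc)
    ultimately have "h j = a + 2" "h (j + 2) = a + 1" using hj by linarith+
    with sj ej show ?case unfolding Teq mem_strip_col by simp
  qed
qed

section \<open>Contracting three columns to one\<close>

text \<open>\<open>lift j\<close> inserts an addable node in column \<open>j + 1\<close> into a path by splitting column \<open>j + 1\<close> into the
  columns \<open>j\<close>, \<open>j + 1\<close>, \<open>j + 2\<close>; \<open>contract j\<close> is the corresponding map of nodes in the opposite direction.\<close>

definition squeeze :: "int \<Rightarrow> int \<Rightarrow> int" where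
  "squeeze j c = (if c \<le> j then c + 1 else if c = j + 1 then c else c - 1)"

definition lift :: "int \<Rightarrow> (int \<Rightarrow> int) \<Rightarrow> int \<Rightarrow> int" where
  "lift j h c = h (squeeze j c) + (if c \<le> j then 1 else 0)"

definition contract :: "int \<Rightarrow> node \<Rightarrow> node" where
  "contract j = (\<lambda>(a, b). let c = b - a; a' = a - (if c \<le> j then 1 else 0) in (a', a' + squeeze j c))"

text \<open>A tile meeting the collapsed column acquires all of the columns j, j + 1, j + 2, so an
  endpoint in column j + 1 moves outward, to j or to j + 2. Both endpoint maps are strictly
  increasing and avoid j + 1.\<close>

abbreviation lift_start :: "int \<Rightarrow> int \<Rightarrow> int" where
  "lift_start j s \<equiv> if s \<le> j + 1 then s - 1 else s + 1"

abbreviation lift_end :: "int \<Rightarrow> int \<Rightarrow> int" where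
  "lift_end j e \<equiv> if e \<ge> j + 1 then e + 1 else e - 1"

lemma node_cases:
  fixes n :: node
  obtains a c where "n = (a, a + c)"
  using that[of "fst n" "snd n - fst n"] by simp

lemma contract_col: "contract j (a, a + c) =
    (a - (if c \<le> j then 1 else 0), a - (if c \<le> j then 1 else 0) + squeeze j c)"
  by (simp add: contract_def Let_def)

lemma contract_Nn: "contract j (Nn n) = Nn (contract j n)"
  by (simp add: contract_def Nn_def Let_def split: prod.split)

text \<open>Surjectivity makes taking preimages injective, so that tilings are transported without
  loss.\<close>

lemma surj_contract: "surj (contract j)"
proof (rule surjI)
  fix n :: node
  obtain a c where "n = (a, a + c)" by (rule node_cases)
  then show "contract j (if column n \<le> j + 1 then (fst n + 1, snd n) else (fst n, snd n + 1)) = n"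
    by (auto simp: contract_def squeeze_def column_def Let_def)
qed

lemma region_lift: "region (lift j A) (lift j B) = contract j -` region A B"
proof (intro set_eqI)
  fix n :: node
  obtain a c where n: "n = (a, a + c)" by (rule node_cases)
  show "n \<in> region (lift j A) (lift j B) \<longleftrightarrow> n \<in> contract j -` region A B"
    unfolding n vimage_eq contract_col mem_region_col by (auto simp: lift_def)
qed

lemma strip_lift:
  "strip (lift j h) (lift_start j s) (lift_end j e) = contract j -` strip h s e"
proof (intro set_eqI)
  fix n :: node
  obtain a c where n: "n = (a, a + c)" by (rule node_cases)
  show "n \<in> strip (lift j h) (lift_start j s) (lift_end j e) \<longleftrightarrow> n \<in> contract j -` strip h s e"
    unfolding n vimage_eq contract_col mem_strip_col by (auto simp: lift_def squeeze_def)
qed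

text \<open>Lifting raises all heights by one except at the bottom of the new valley. As no lifted
  tile starts or ends in column j + 1, the Dyck inequalities survive the shift.\<close>

lemma lift_height:
  "2 * lift j h c + c = 2 * h (squeeze j c) + squeeze j c + (if c = j + 1 then 0 else 1)"
  by (simp add: lift_def squeeze_def)

lemma dyck_path_cong:
  assumes d: "dyck_path h s e" and eq: "\<And>c. s \<le> c \<Longrightarrow> c \<le> e \<Longrightarrow> h c = h' c"
  shows "dyck_path h' s e"
  unfolding dyck_path_def
proof (intro conjI allI impI)
  show se: "s \<le> e" by (rule dyck_path_ends[OF d])
  show "2 * h' e + e = 2 * h' s + s" using dyck_path_ends[OF d] eq[of e] eq[of s] by simp
  fix c
  {
    assume "s \<le> c \<and> c < e"
    then show "h' (c + 1) = h' c \<or> h' (c + 1) = h' c - 1"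
      using dyck_path_step[OF d, of c] eq[of c] eq[of "c + 1"] by simp
  next
    assume "s \<le> c \<and> c \<le> e"
    then show "2 * h' c + c \<le> 2 * h' s + s"
      using dyck_path_le[OF d, of c] eq[of c] eq[of s] se by simp
  }
qed

lemma dyck_path_lift:
  assumes "dyck_path h s e"
  shows "dyck_path (lift j h) (lift_start j s) (lift_end j e)" (is "dyck_path _ ?s ?e")
  unfolding dyck_path_def
proof (intro conjI allI impI)
  have "s \<le> e" by (rule dyck_path_ends[OF assms])
  then show "?s \<le> ?e" by simp
  show "2 * lift j h ?e + ?e = 2 * lift j h ?s + ?s"
    unfolding lift_height using dyck_path_ends[OF assms] by (simp add: squeeze_def)
  fix c
  {
    assume c: "?s \<le> c \<and> c < ?e"
    consider "c < j" | "c = j" | "c = j + 1" | "j + 1 < c" by linarith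
    then show "lift j h (c + 1) = lift j h c \<or> lift j h (c + 1) = lift j h c - 1"
    proof cases
      case 1
      with c have "s \<le> c + 1" "c + 1 < e" by (simp_all split: if_splits)
      from dyck_path_step[OF assms this] 1 show ?thesis by (auto simp: lift_def squeeze_def)
    next
      case 4
      with c have "s \<le> c - 1" "c - 1 < e" by (simp_all split: if_splits)
      from dyck_path_step[OF assms this] 4 show ?thesis by (auto simp: lift_def squeeze_def)
    qed (simp_all add: lift_def squeeze_def add.commute)
  next
    assume c: "?s \<le> c \<and> c \<le> ?e"
    then have "s \<le> squeeze j c" "squeeze j c \<le> e" by (auto simp: squeeze_def split: if_splits)
    from dyck_path_le[OF assms this] show "2 * lift j h c + c \<le> 2 * lift j h ?s + ?s"
      unfolding lift_height by (auto simp: squeeze_def)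
  }
qed

lemma dyck_path_unlift:
  assumes d: "dyck_path (lift j h) (lift_start j s) (lift_end j e)" (is "dyck_path _ ?s ?e")
    and le: "s \<le> e"
  shows "dyck_path h s e"
  unfolding dyck_path_def
proof (intro conjI allI impI)
  show "s \<le> e" by fact
  show "2 * h e + e = 2 * h s + s"
    using dyck_path_ends(1)[OF d] unfolding lift_height by (simp add: squeeze_def split: if_splits)
  fix c
  {
    assume c: "s \<le> c \<and> c < e"
    show "h (c + 1) = h c \<or> h (c + 1) = h c - 1"
    \<comment> \<open>The step of \<open>h\<close> at c reappears in \<open>lift j h\<close> at c -
      1 on the left and at c + 1 on the right; the steps at j and j + 1 form the inserted
      valley.\<close>
    proof (cases "c \<le> j")
      case True
      with c have "?s \<le> c - 1" "c - 1 < ?e" by auto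
      from dyck_path_step[OF d this] True show ?thesis
        by (auto simp: lift_def squeeze_def add.commute split: if_splits)
    next
      case False
      with c have "?s \<le> c + 1" "c + 1 < ?e" by auto
      from dyck_path_step[OF d this] False show ?thesis
        by (auto simp: lift_def squeeze_def add.commute split: if_splits)
    qed
  next
    assume c: "s \<le> c \<and> c \<le> e"
    show "2 * h c + c \<le> 2 * h s + s"
    proof (cases "c \<le> j + 1")
      case True
      with c have "?s \<le> c - 1" "c - 1 \<le> ?e" by auto
      from dyck_path_le[OF d this] True show ?thesis
        by (auto simp: lift_def squeeze_def add.commute split: if_splits)
    next
      case False
      with c have "?s \<le> c + 1" "c + 1 \<le> ?e" by auto
      from dyck_path_le[OF d this] False show ?thesis
        by (auto simp: lift_def squeeze_def add.commute split: if_splits)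
    qed
  }
qed

text \<open>A tile that is a union of fibres of \<open>contract\<close> meets the columns j, j + 1,
  j + 2 all at once or not at all. So \<open>h\<close> can be read off the columns up to j and
  beyond j + 2, and saturation recovers the two columns left out.\<close>

lemma dyck_tile_contract:
  assumes T: "dyck_tile T" and sat: "\<And>x y. x \<in> T \<Longrightarrow> contract j x = contract j y \<Longrightarrow> y \<in> T"
  obtains T' where "dyck_tile T'" "T = contract j -` T'"
proof -
  obtain h' s' e' where d: "dyck_path h' s' e'" and Teq: "T = strip h' s' e'"
    using T by (auto simp: dyck_tile_iff)
  define h where "h c = (if c \<le> j + 1 then h' (c - 1) - 1 else h' (c + 1))" for c
  define s where "s = (if s' \<le> j then s' + 1 else s' - 1)"
  define e where "e = (if e' \<ge> j + 2 then e' - 1 else e' + 1)"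
  have V: "s' \<le> c' \<and> c' \<le> e' \<and> h' c' = h' c - (if c \<le> j then 1 else 0) + (if c' \<le> j then 1 else 0)"
    if c: "s' \<le> c" "c \<le> e'" "squeeze j c = squeeze j c'" for c c'
  proof -
    let ?a = "h' c - (if c \<le> j then 1 else 0) + (if c' \<le> j then 1 else 0)"
    have "(h' c, h' c + c) \<in> T" unfolding Teq mem_strip_col using c by simp
    moreover have "contract j (h' c, h' c + c) = contract j (?a, ?a + c')"
      unfolding contract_col using c by simp
    ultimately have "(?a, ?a + c') \<in> T" by (rule sat)
    then show ?thesis unfolding Teq mem_strip_col by simp
  qed
  have sq: "squeeze j j = j + 1" "squeeze j (j + 1) = j + 1" "squeeze j (j + 2) = j + 1"
    by (simp_all add: squeeze_def)
  have s'le: "s' \<le> e'" by (rule dyck_path_ends[OF d])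
  \<comment> \<open>A start in column j + 1 or j + 2 would by saturation bring in column j, which is
    further left; likewise for the end and column j + 2.\<close>
  have sne: "s' \<noteq> j + 1" "s' \<noteq> j + 2"
    using V[of s' j] s'le sq by auto
  have ene: "e' \<noteq> j" "e' \<noteq> j + 1"
    using V[of e' "j + 2"] s'le sq by auto
  have se: "s' = lift_start j s" "e' = lift_end j e" "s \<le> e"
    using sne ene s'le by (auto simp: s_def e_def)
  have hlift: "h' c = lift j h c" if "s' \<le> c" "c \<le> e'" for c
  proof -
    consider "c \<le> j" | "c = j + 1" | "c = j + 2" | "j + 2 < c" by linarith
    then show ?thesis
      by cases (use V[of c j] that sq in \<open>auto simp: lift_def squeeze_def h_def\<close>)
  qed
  have "T = strip (lift j h) s' e'" unfolding Teq strip_def using hlift by auto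
  then have "T = contract j -` strip h s e" using strip_lift se by simp
  moreover have "dyck_path (lift j h) s' e'"
    using d hlift by (rule dyck_path_cong)
  then have "dyck_path h s e" unfolding se(1,2) using se(3) by (rule dyck_path_unlift)
  ultimately show thesis using that dyck_tile_iff by blast
qed

lemma dyck_tile_vimage_contract:
  assumes "dyck_tile T"
  shows "dyck_tile (contract j -` T)"
    and "start_col (contract j -` T) = lift_start j (start_col T)"
    and "end_col (contract j -` T) = lift_end j (end_col T)"
proof -
  obtain h s e where d: "dyck_path h s e" and T: "T = strip h s e"
    using assms by (auto simp: dyck_tile_iff)
  note d' = dyck_path_lift[OF d, of j]
  have eq: "contract j -` T = strip (lift j h) (lift_start j s) (lift_end j e)"
    unfolding T by (rule strip_lift[symmetric])
  show "dyck_tile (contract j -` T)" unfolding dyck_tile_iff using d' eq by blast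
  show "start_col (contract j -` T) = lift_start j (start_col T)"
    unfolding eq unfolding T start_col_strip[OF dyck_path_ends(2)[OF d]]
    by (rule start_col_strip[OF dyck_path_ends(2)[OF d']])
  show "end_col (contract j -` T) = lift_end j (end_col T)"
    unfolding eq unfolding T end_col_strip[OF dyck_path_ends(2)[OF d]]
    by (rule end_col_strip[OF dyck_path_ends(2)[OF d']])
qed

text \<open>Preimages under a surjection preserve and reflect unions and disjointness.
  \<open>contract\<close> commutes with \<open>Nn\<close>, and the endpoint maps are strictly
  increasing, so cover inclusion transfers in both directions.\<close>

lemma ci_tilings_vimage_contract:
  assumes dyck: "\<And>T. T \<in> \<T> \<Longrightarrow> dyck_tile T"
  shows "vimage (contract j) ` \<T> \<in> ci_tilings (contract j -` D) \<longleftrightarrow> \<T> \<in> ci_tilings D"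
proof -
  let ?p = "contract j"
  have inj: "?p -` X = ?p -` Y \<longleftrightarrow> X = Y" for X Y
    using surj_contract[of j] by (metis surj_image_vimage_eq)
  have "\<Union>(vimage ?p ` \<T>) = ?p -` D \<longleftrightarrow> \<Union>\<T> = D"
    using inj[of "\<Union>\<T>" D] by (simp add: vimage_Union)
  moreover have "?p -` X \<inter> ?p -` Y = {} \<longleftrightarrow> X \<inter> Y = {}" for X Y
    unfolding vimage_Int[symmetric] using inj[of "X \<inter> Y" "{}"] by simp
  ultimately have tiling: "dyck_tiling (?p -` D) (vimage ?p ` \<T>) \<longleftrightarrow> dyck_tiling D \<T>"
    unfolding dyck_tiling_def ball_simps inj using dyck dyck_tile_vimage_contract(1) by simp
  have all: "(\<forall>a. Q (?p a)) \<longleftrightarrow> (\<forall>a. Q a)" for Q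
    using surj_contract[of j] by (metis surjD)
  have "start_col (?p -` T') \<le> start_col (?p -` T) \<and> end_col (?p -` T) \<le> end_col (?p -` T') \<longleftrightarrow>
      start_col T' \<le> start_col T \<and> end_col T \<le> end_col T'" if "T \<in> \<T>" "T' \<in> \<T>" for T T'
    unfolding dyck_tile_vimage_contract(2,3)[OF dyck[OF that(1)]]
      dyck_tile_vimage_contract(2,3)[OF dyck[OF that(2)]] by auto
  then have "cover_inclusive (?p -` D) (vimage ?p ` \<T>) \<longleftrightarrow>
      (\<forall>a. ?p a \<in> D \<and> Nn (?p a) \<in> D \<longrightarrow> (\<forall>T\<in>\<T>. \<forall>T'\<in>\<T>. ?p a \<in> T \<and> Nn (?p a) \<in> T' \<longrightarrow>
        start_col T' \<le> start_col T \<and> end_col T \<le> end_col T'))"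
    unfolding cover_inclusive_def by (simp add: contract_Nn)
  also have "\<dots> \<longleftrightarrow> cover_inclusive D \<T>"
    unfolding cover_inclusive_def
    by (rule all[of "\<lambda>x. x \<in> D \<and> Nn x \<in> D \<longrightarrow> (\<forall>T\<in>\<T>. \<forall>T'\<in>\<T>. x \<in> T \<and> Nn x \<in> T' \<longrightarrow>
        start_col T' \<le> start_col T \<and> end_col T \<le> end_col T')"])
  finally show ?thesis using tiling by (simp add: ci_tilings_def)
qed

section \<open>Tilings with and without a singleton tile at the addable node\<close>

definition valley_node :: "(int \<Rightarrow> int) \<Rightarrow> int \<Rightarrow> node" where
  "valley_node B j = (B (j + 1) + 1, B (j + 1) + 1 + (j + 1))"

lemma lift_valley:
  "lift j h j = h (j + 1) + 1" "lift j h (j + 1) = h (j + 1)" "lift j h (j + 2) = h (j + 1)"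
  by (simp_all add: lift_def squeeze_def add.commute)

text \<open>Away from the singleton at the valley, every tile meeting column \<open>j + 1\<close> crosses it in
  a valley, so contracting the columns \<open>j\<close>, \<open>j + 1\<close>, \<open>j + 2\<close> to one loses nothing.\<close>

lemma card_ci_tilings_lift:
  "card (ci_tilings (region A B)) =
   card {\<T> \<in> ci_tilings (region (lift j A) (lift j B)). {valley_node (lift j B) j} \<notin> \<T>}"
proof (rule bij_betw_same_card)
  let ?p = "contract j" and ?n = "valley_node (lift j B) j"
  let ?D = "region (lift j A) (lift j B)"
  let ?S = "{\<T> \<in> ci_tilings ?D. {?n} \<notin> \<T>}"
  have dyck: "dyck_tile T" if "\<T> \<in> ci_tilings D" "T \<in> \<T>" for D \<T> T
    using that by (auto simp: ci_tilings_def dyck_tiling_def)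
  have "inj (vimage ?p)"
    using surj_contract[of j] by (intro injI) (metis surj_image_vimage_eq)
  then have "inj_on (image (vimage ?p)) (ci_tilings (region A B))"
    by (intro inj_onI) (simp add: inj_image_eq_iff)
  moreover have "image (vimage ?p) ` ci_tilings (region A B) = ?S"
  proof (intro equalityI subsetI)
    fix \<T> assume "\<T> \<in> image (vimage ?p) ` ci_tilings (region A B)"
    then obtain \<T>' where \<T>': "\<T>' \<in> ci_tilings (region A B)" "\<T> = vimage ?p ` \<T>'" by blast
    have "{?n} \<noteq> ?p -` X" for X
    proof
      assume eq: "{?n} = ?p -` X"
      \<comment> \<open>A second node in the fibre of the valley node, one column to the right: no
        preimage is a single node there.\<close>
      let ?m = "(lift j B (j + 1) + 1, lift j B (j + 1) + 1 + (j + 2))"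
      have "?p ?m = ?p ?n"
        unfolding valley_node_def contract_col by (simp add: squeeze_def)
      then have "?m \<in> {?n}" using eq by (metis singletonI vimage_eq)
      then show False by (simp add: valley_node_def)
    qed
    then show "\<T> \<in> ?S"
      using \<T>' ci_tilings_vimage_contract[of \<T>' j "region A B"] dyck[OF \<T>'(1)]
      by (auto simp: region_lift)
  next
    fix \<T> assume "\<T> \<in> ?S"
    then have T: "\<T> \<in> ci_tilings ?D" and n: "{?n} \<notin> \<T>" by simp_all
    have sat: "y \<in> T" if mem: "T \<in> \<T>" "x \<in> T" and eq: "?p x = ?p y" for T x y
    proof -
      obtain a c where x: "x = (a, a + c)" by (rule node_cases)
      obtain a' c' where y: "y = (a', a' + c')" by (rule node_cases)
      define d where "d = a - (if c \<le> j then 1 else 0)"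
      have d': "d = a' - (if c' \<le> j then 1 else 0)" and sq: "squeeze j c = squeeze j c'"
        using eq by (simp_all add: x y contract_col d_def)
      show ?thesis
      proof (cases "c = c'")
        case True
        with d' mem show ?thesis by (simp add: x y d_def split: if_splits)
      next
        case False
        with sq have c: "c \<in> {j, j + 1, j + 2}" "c' \<in> {j, j + 1, j + 2}"
          by (auto simp: squeeze_def split: if_splits)
        \<comment> \<open>The fibre of x is a V with first coordinates d + 1, d, d in the columns j,
          j + 1, j + 2. The tile T0 of its middle node contains the whole V by
          \<open>ci_tilings_valley\<close>.\<close>
        have "?p (d, d + (j + 1)) = ?p x"
          using c by (auto simp: x contract_col squeeze_def d_def)
        moreover have "x \<in> ?D" using T mem ci_tilings_subset by blast
        ultimately have "(d, d + (j + 1)) \<in> ?D" by (simp add: region_lift)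
        then obtain T0 where T0: "T0 \<in> \<T>" "(d, d + (j + 1)) \<in> T0"
          using T ci_tilings_obtain by blast
        have "(d + 1, d + 1 + j) \<in> T0 \<and> (d, d + (j + 2)) \<in> T0"
          by (rule ci_tilings_valley[OF T _ _ _ T0])
            (use n in \<open>simp_all add: lift_valley valley_node_def\<close>)
        with T0 c have "x \<in> T0" "y \<in> T0"
          using d_def d' by (auto simp: x y algebra_simps)
        with mem T0 show ?thesis using ci_tilings_unique[OF T] by blast
      qed
    qed
    let ?U = "{T. dyck_tile T \<and> ?p -` T \<in> \<T>}"
    have "vimage ?p ` ?U = \<T>"
    proof (intro equalityI subsetI)
      fix T assume "T \<in> \<T>"
      then obtain T' where "dyck_tile T'" "T = ?p -` T'"
        using dyck_tile_contract[of T j] dyck[OF T] sat by metis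
      with \<open>T \<in> \<T>\<close> show "T \<in> vimage ?p ` ?U" by blast
    qed blast
    moreover from this have "?U \<in> ci_tilings (region A B)"
      using ci_tilings_vimage_contract[of ?U j "region A B"] T by (simp add: region_lift)
    ultimately show "\<T> \<in> image (vimage ?p) ` ci_tilings (region A B)" by blast
  qed
  ultimately show "bij_betw (image (vimage ?p)) (ci_tilings (region A B)) ?S"
    by (simp add: bij_betw_def)
qed

text \<open>By \<open>below\<close>, no node of D has n directly above it, so the only new cover
  condition compares {n} with the tile of \<open>Nn n\<close>. That tile meets the one column of
  {n}, so it is at least as wide.\<close>

lemma card_ci_tilings_singleton:
  assumes n: "n \<notin> D" and below: "\<And>a. a \<in> D \<Longrightarrow> Nn a \<noteq> n"
  shows "card {\<T> \<in> ci_tilings (insert n D). {n} \<in> \<T>} = card (ci_tilings D)"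
proof (rule sym, rule bij_betw_same_card, rule bij_betw_byWitness[where f = "insert {n}" and f' = "\<lambda>\<T>. \<T> - {{n}}"])
  obtain a c where nac: "n = (a, a + c)" by (rule node_cases)
  have strip: "{n} = strip (\<lambda>_. a) c c" by (simp add: strip_def nac add.commute)
  have col: "start_col {n} = c" "end_col {n} = c"
    unfolding strip by (simp_all add: start_col_strip end_col_strip)
  have dyck: "dyck_tile {n}"
    unfolding dyck_tile_iff using strip by (intro exI[of _ "\<lambda>_. a"] exI[of _ c]) (simp add: dyck_path_def)
  show "\<forall>\<T>\<in>ci_tilings D. insert {n} \<T> - {{n}} = \<T>"
    using n ci_tilings_subset by blast
  show "\<forall>\<T>\<in>{\<T> \<in> ci_tilings (insert n D). {n} \<in> \<T>}. insert {n} (\<T> - {{n}}) = \<T>"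
    by blast
  show "insert {n} ` ci_tilings D \<subseteq> {\<T> \<in> ci_tilings (insert n D). {n} \<in> \<T>}"
  proof clarify
    fix \<T> assume T: "\<T> \<in> ci_tilings D"
    have "n \<notin> T" if "T \<in> \<T>" for T using ci_tilings_subset[OF T that] n by blast
    then have "dyck_tiling (insert n D) (insert {n} \<T>)"
      using T dyck unfolding ci_tilings_def dyck_tiling_def by auto
    moreover have "cover_inclusive (insert n D) (insert {n} \<T>)"
      unfolding cover_inclusive_def
    proof (intro allI impI ballI)
      fix x T T'
      assume x: "x \<in> insert n D \<and> Nn x \<in> insert n D" and TT': "T \<in> insert {n} \<T>" "T' \<in> insert {n} \<T>"
        "x \<in> T \<and> Nn x \<in> T'"
      have "Nn n \<noteq> n" by (simp add: Nn_def nac)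
      then have "Nn x \<noteq> n" using x below by (metis insertE)
      with TT' have T': "T' \<in> \<T>" by blast
      show "start_col T' \<le> start_col T \<and> end_col T \<le> end_col T'"
      proof (cases "T = {n}")
        case True
        with TT' have "x = n" by blast
        with TT' have mem: "(a + 1, a + 1 + c) \<in> T'" by (simp add: nac Nn_def algebra_simps)
        obtain h s e where T'eq: "T' = strip h s e" and se: "start_col T' = s" "end_col T' = e"
          using T T' by (rule ci_tilings_strip)
        from mem show ?thesis unfolding True col se unfolding T'eq mem_strip_col by simp
      next
        case False
        then show ?thesis using TT' T' ci_tilings_cover[OF T, of T T' x] by simp
      qed
    qed
    ultimately show "insert {n} \<T> \<in> ci_tilings (insert n D) \<and> {n} \<in> insert {n} \<T>"
      by (simp add: ci_tilings_def)
  qed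
  show "(\<lambda>\<T>. \<T> - {{n}}) ` {\<T> \<in> ci_tilings (insert n D). {n} \<in> \<T>} \<subseteq> ci_tilings D"
  proof clarify
    fix \<T> assume T: "\<T> \<in> ci_tilings (insert n D)" "{n} \<in> \<T>"
    then have "n \<notin> T" if "T \<in> \<T> - {{n}}" for T
      using that ci_tilings_unique[OF T(1), of T "{n}" n] by blast
    then have "\<Union>(\<T> - {{n}}) = \<Union>\<T> - {n}" using T by blast
    also have "\<dots> = D" using T n by (simp add: ci_tilings_def dyck_tiling_def)
    finally have "dyck_tiling D (\<T> - {{n}})"
      using T(1) by (simp add: ci_tilings_def dyck_tiling_def)
    moreover have "cover_inclusive D (\<T> - {{n}})"
      unfolding cover_inclusive_def
    proof (intro allI impI ballI)
      fix x T T'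
      assume "T \<in> \<T> - {{n}}" "T' \<in> \<T> - {{n}}" "x \<in> T \<and> Nn x \<in> T'"
      then show "start_col T' \<le> start_col T \<and> end_col T \<le> end_col T'"
        using ci_tilings_cover[OF T(1), of T T' x] by simp
    qed
    ultimately show "\<T> - {{n}} \<in> ci_tilings D" by (simp add: ci_tilings_def)
  qed
qed

lemma region_below_valley_node:
  assumes "B (j + 1) < A (j + 1)"
  shows "region A B = insert (valley_node B j) (region A (B(j + 1 := B (j + 1) + 1)))"
proof (intro set_eqI)
  fix n :: node
  obtain a c where n: "n = (a, a + c)" by (rule node_cases)
  show "n \<in> region A B \<longleftrightarrow> n \<in> insert (valley_node B j) (region A (B(j + 1 := B (j + 1) + 1)))"
    unfolding n insert_iff mem_region_col valley_node_def using assms by auto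
qed

lemma card_ci_tilings_valley_node:
  assumes "B (j + 1) < A (j + 1)"
  shows "card {\<T> \<in> ci_tilings (region A B). {valley_node B j} \<in> \<T>} =
    card (ci_tilings (region A (B(j + 1 := B (j + 1) + 1))))"
  unfolding region_below_valley_node[of B j A, OF assms]
proof (rule card_ci_tilings_singleton)
  show "valley_node B j \<notin> region A (B(j + 1 := B (j + 1) + 1))"
    unfolding valley_node_def mem_region_col by simp
  fix x assume x: "x \<in> region A (B(j + 1 := B (j + 1) + 1))"
  obtain a c where xac: "x = (a, a + c)" by (rule node_cases)
  from x show "Nn x \<noteq> valley_node B j"
    unfolding xac mem_region_col by (auto simp: Nn_def valley_node_def)
qed

text \<open>The tile of the topmost node in column j + 1 has a valley there, and its two
  neighbouring nodes still lie below A. Hence A has a valley above that of B.\<close>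

lemma ci_tilings_peak:
  assumes T: "\<T> \<in> ci_tilings (region A B)" and n: "{valley_node B j} \<notin> \<T>"
    and A: "\<And>c. A (c + 1) \<le> A c" "\<And>c. A c \<le> A (c + 1) + 1" and le: "\<And>c. B c \<le> A c"
    and B: "B j = B (j + 1) + 1" "B (j + 2) = B (j + 1)"
  shows "A j = A (j + 1) + 1" "A (j + 2) = A (j + 1)"
proof -
  have "A (j + 1) + 1 \<le> A j \<and> A (j + 1) \<le> A (j + 2)"
  proof (cases "B (j + 1) < A (j + 1)")
    case True
    then have "(A (j + 1), A (j + 1) + (j + 1)) \<in> region A B" by (simp add: mem_region_col)
    then obtain T where mem: "T \<in> \<T>" "(A (j + 1), A (j + 1) + (j + 1)) \<in> T"
      using T ci_tilings_obtain by blast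
    have "(A (j + 1) + 1, A (j + 1) + 1 + j) \<in> T \<and> (A (j + 1), A (j + 1) + (j + 2)) \<in> T"
      using ci_tilings_valley[OF T B _ mem] n unfolding valley_node_def by blast
    then have "(A (j + 1) + 1, A (j + 1) + 1 + j) \<in> region A B \<and>
        (A (j + 1), A (j + 1) + (j + 2)) \<in> region A B"
      using ci_tilings_subset[OF T mem(1)] by blast
    then show ?thesis unfolding mem_region_col by simp
  next
    case False
    \<comment> \<open>The column is empty, so A touches B in it while staying above B in both
      neighbouring columns.\<close>
    with le[of "j + 1"] le[of j] le[of "j + 2"] B show ?thesis by linarith
  qed
  with A(2)[of j] A(1)[of "j + 1"] show "A j = A (j + 1) + 1" "A (j + 2) = A (j + 1)"
    by (simp_all add: add.assoc)
qed

section \<open>Words and the recursion for tiling numbers\<close>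

definition trues :: "bool list \<Rightarrow> nat" where
  "trues u = length (filter id u)"

lemma trues_simps [simp]:
  "trues [] = 0" "trues (x # u) = (if x then Suc (trues u) else trues u)"
  "trues (u @ v) = trues u + trues v" "trues (replicate n False) = 0" "trues (replicate n True) = n"
  by (simp_all add: trues_def)

lemma trues_le_length: "trues u \<le> length u"
  by (simp add: trues_def)

text \<open>A word records the boundary path of a partition in a box of height \<open>trues u\<close>, read from the
  left, with \<open>True\<close> for the step across a row and \<open>False\<close> for the step across a column; \<open>profile u c\<close> is
  the largest first coordinate below the path in column \<open>c\<close>.\<close>

definition profile :: "bool list \<Rightarrow> int \<Rightarrow> int" where
  "profile u c = int (trues (drop (nat (c + int (trues u))) u))"

definition cut :: "nat \<Rightarrow> 'b list \<Rightarrow> 'b list" where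
  "cut i u = take i u @ drop (i + 2) u"

lemma cut_append [simp]: "cut (length u1) (u1 @ a # b # u2) = u1 @ u2"
  by (simp add: cut_def)

definition words :: "nat \<Rightarrow> nat \<Rightarrow> bool list set" where
  "words f g = {u. length u = f + g \<and> trues u = g}"

definition tiling_number :: "bool list \<Rightarrow> bool list \<Rightarrow> nat" where
  "tiling_number u v =
     (if profile v \<le> profile u then card (ci_tilings (region (profile u) (profile v))) else 0)"

lemma finite_words: "finite (words f g)"
proof (rule finite_subset)
  show "words f g \<subseteq> {u. set u \<subseteq> UNIV \<and> length u = f + g}" by (auto simp: words_def)
qed (rule finite_lists_length_eq, simp)

lemma profile_nonneg: "0 \<le> profile u c"
  by (simp add: profile_def)

lemma trues_drop_Suc: "p < length u \<Longrightarrow> trues (drop p u) = trues (drop (Suc p) u) + (if u ! p then 1 else 0)"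
  by (simp add: Cons_nth_drop_Suc[symmetric])

lemma profile_step: "profile u (c + 1) \<le> profile u c" "profile u c \<le> profile u (c + 1) + 1"
proof -
  let ?p = "nat (c + int (trues u))"
  have "profile u (c + 1) = profile u c \<or> profile u c = int (trues (drop ?p u)) \<and>
      profile u (c + 1) = int (trues (drop (Suc ?p) u))"
  proof (cases "c + int (trues u) < 0")
    case False
    then have "nat (c + 1 + int (trues u)) = Suc ?p" by simp
    then show ?thesis by (simp add: profile_def)
  qed (simp add: profile_def)
  moreover have "trues (drop (Suc ?p) u) \<le> trues (drop ?p u) \<and>
      trues (drop ?p u) \<le> trues (drop (Suc ?p) u) + 1"
    by (cases "?p < length u") (simp_all add: trues_drop_Suc)
  ultimately show "profile u (c + 1) \<le> profile u c" "profile u c \<le> profile u (c + 1) + 1"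
    by auto
qed

text \<open>Position p of a word is column p - \<open>trues\<close>. Inserting TF raises
  \<open>trues\<close> by one: left of it positions stay, columns drop by one and one more True lies
  ahead; right of it positions grow by two and columns by one. The corner between the new letters is
  column j + 1.\<close>

lemma profile_insert_valley:
  "profile (u1 @ True # False # u2) = lift (int (length u1) - int (trues (u1 @ u2)) - 1) (profile (u1 @ u2))"
proof
  fix c
  let ?g = "int (trues (u1 @ u2)) + 1" and ?l = "int (length u1)"
  consider "c + ?g \<le> ?l" | "c + ?g = ?l + 1" | "?l + 2 \<le> c + ?g" by linarith
  then show "profile (u1 @ True # False # u2) c = lift (?l - int (trues (u1 @ u2)) - 1) (profile (u1 @ u2)) c"
  proof cases
    case 1
    define p where "p = nat (c + ?g)"
    have "nat (c + int (trues (u1 @ True # False # u2))) = p" "nat (c + 1 + int (trues (u1 @ u2))) = p"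
      by (simp_all add: p_def algebra_simps)
    moreover have "p \<le> length u1" using 1 by (simp add: p_def)
    ultimately show ?thesis using 1 by (simp add: lift_def squeeze_def profile_def)
  next
    case 2
    then have "nat (c + int (trues (u1 @ True # False # u2))) = Suc (length u1)"
      "nat (c + int (trues (u1 @ u2))) = length u1"
      by auto
    with 2 show ?thesis by (simp add: lift_def squeeze_def profile_def)
  next
    case 3
    define p where "p = nat (c + ?g - ?l - 2)"
    have "nat (c + int (trues (u1 @ True # False # u2))) = length u1 + Suc (Suc p)"
      "nat (c - 1 + int (trues (u1 @ u2))) = length u1 + p"
      using 3 by (auto simp: p_def)
    with 3 show ?thesis by (simp add: lift_def squeeze_def profile_def)
  qed
qed

lemma profile_flip:
  "profile (u1 @ False # True # u2) = (profile (u1 @ True # False # u2))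
     (int (length u1) - int (trues (u1 @ u2)) := profile (u1 @ u2) (int (length u1) - int (trues (u1 @ u2))) + 1)"
proof
  fix c
  let ?g = "int (trues (u1 @ u2)) + 1" and ?l = "int (length u1)"
  consider "c + ?g \<le> ?l" | "c + ?g = ?l + 1" | "?l + 2 \<le> c + ?g" by linarith
  then show "profile (u1 @ False # True # u2) c = ((profile (u1 @ True # False # u2))
     (?l - int (trues (u1 @ u2)) := profile (u1 @ u2) (?l - int (trues (u1 @ u2))) + 1)) c"
  proof cases
    case 1
    then show ?thesis by (simp add: profile_def)
  next
    case 2
    then have c: "c = ?l - int (trues (u1 @ u2))" by simp
    have "nat (c + int (trues (u1 @ True # False # u2))) = Suc (length u1)"
      "nat (c + int (trues (u1 @ u2))) = length u1"
      using 2 by auto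
    then show ?thesis unfolding c by (simp add: profile_def)
  next
    case 3
    define p where "p = nat (c + ?g - ?l - 2)"
    have "nat (c + int (trues (u1 @ True # False # u2))) = length u1 + Suc (Suc p)"
      using 3 by (auto simp: p_def)
    with 3 show ?thesis by (simp add: profile_def)
  qed
qed

lemma lift_le_iff: "lift j A \<le> lift j B \<longleftrightarrow> A \<le> B"
proof
  assume le: "lift j A \<le> lift j B"
  have "A c \<le> B c" for c
  proof (cases "c \<le> j + 1")
    case True
    then show ?thesis using le_funD[OF le, of "c - 1"] by (simp add: lift_def squeeze_def)
  next
    case False
    then show ?thesis using le_funD[OF le, of "c + 1"] by (simp add: lift_def squeeze_def)
  qed
  then show "A \<le> B" by (rule le_funI)
qed (simp add: le_fun_def lift_def)

lemma tiling_number_insert_valley: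
  assumes "length u1 = length v1" "trues (u1 @ u2) = trues (v1 @ v2)"
    and j: "j = int (length v1) - int (trues (v1 @ v2)) - 1"
  defines "A \<equiv> profile (u1 @ True # False # u2)" and "B \<equiv> profile (v1 @ True # False # v2)"
  shows "tiling_number (u1 @ u2) (v1 @ v2) = (if B \<le> A then
    card {\<T> \<in> ci_tilings (region A B). {valley_node B j} \<notin> \<T>} else 0)"
proof -
  have "A = lift j (profile (u1 @ u2))" "B = lift j (profile (v1 @ v2))"
    unfolding A_def B_def using assms by (simp_all only: profile_insert_valley)
  then show ?thesis
    by (simp add: tiling_number_def lift_le_iff card_ci_tilings_lift[of _ _ j])
qed

text \<open>Far to the left both profiles equal the common number of letters True, and far to the
  right both vanish, so the region stays within the columns of the box. The bounds on the
  coordinates are crude.\<close>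

lemma finite_region_profile:
  assumes "length u = length v" "trues u = trues v"
  shows "finite (region (profile u) (profile v))"
proof (rule finite_subset)
  let ?N = "int (length u)"
  show "region (profile u) (profile v) \<subseteq> {- ?N..?N} \<times> {- 3 * ?N..3 * ?N}"
  proof clarify
    fix a b assume ab: "(a, b) \<in> region (profile u) (profile v)"
    have le: "profile u (b - a) \<le> ?N"
      using trues_le_length[of "drop (nat (b - a + int (trues u))) u"] by (simp add: profile_def)
    have nn: "0 \<le> profile v (b - a)" by (rule profile_nonneg)
    have g: "int (trues u) \<le> ?N" using trues_le_length[of u] by simp
    have "\<not> b - a + int (trues u) < 0"
    proof
      assume "b - a + int (trues u) < 0"
      with assms ab show False by (auto simp: region_def profile_def)
    qed
    moreover have "\<not> b - a + int (trues u) > ?N"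
    proof
      assume "b - a + int (trues u) > ?N"
      with assms ab show False by (auto simp: region_def profile_def)
    qed
    ultimately show "a \<in> {- ?N..?N} \<and> b \<in> {- 3 * ?N..3 * ?N}"
      using le nn g ab by (auto simp: region_def)
  qed
qed simp

text \<open>The tilings are split by whether the addable node is a singleton tile. Those with it
  tile the region above the path with FT; those without it contract, provided that \<open>u\<close>
  has its own factor TF in that column, and otherwise do not exist.\<close>

lemma tiling_number_rec:
  assumes u: "u \<in> words (Suc f) (Suc g)" and v: "v1 @ v2 \<in> words f g"
  shows "tiling_number u (v1 @ True # False # v2) = tiling_number u (v1 @ False # True # v2) +
    (if \<exists>u1 u2. u = u1 @ True # False # u2 \<and> length u1 = length v1
     then tiling_number (cut (length v1) u) (v1 @ v2) else 0)"
proof -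
  define j where "j = int (length v1) - int (trues (v1 @ v2)) - 1"
  define A where "A = profile u"
  define B where "B = profile (v1 @ True # False # v2)"
  define B' where "B' = profile (v1 @ False # True # v2)"
  define S where "S = {\<T> \<in> ci_tilings (region A B). {valley_node B j} \<notin> \<T>}"
  have Blift: "B = lift j (profile (v1 @ v2))"
    unfolding B_def j_def by (rule profile_insert_valley)
  have B: "B j = B (j + 1) + 1" "B (j + 2) = B (j + 1)"
    unfolding Blift lift_valley by simp_all
  have B'_eq: "B' = B(j + 1 := B (j + 1) + 1)"
    unfolding B'_def profile_flip B_def[symmetric] unfolding Blift lift_valley
    by (simp add: j_def)
  have B'le: "B' \<le> A \<longleftrightarrow> B \<le> A \<and> B (j + 1) < A (j + 1)"
  proof
    assume le: "B' \<le> A"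
    have "B c \<le> B' c" for c by (simp add: B'_eq)
    then have "B \<le> A" using le_funD[OF le] by (meson le_funI order_trans)
    moreover have "B (j + 1) < A (j + 1)" using le_funD[OF le, of "j + 1"] by (simp add: B'_eq)
    ultimately show "B \<le> A \<and> B (j + 1) < A (j + 1)" ..
  qed (simp add: B'_eq le_fun_def)
  have peak: "\<exists>u1 u2. u = u1 @ True # False # u2 \<and> length u1 = length v1"
    if "\<T> \<in> S" "B \<le> A" for \<T>
  proof -
    have Aj: "A j = A (j + 1) + 1" "A (j + 2) = A (j + 1)"
      using ci_tilings_peak[of \<T> A B j] that B profile_step[of u]
      by (simp_all add: S_def A_def le_fun_def)
    let ?i = "length v1"
    have len: "?i + 2 \<le> length u" using u v by (auto simp: words_def)
    have tr: "trues u = trues (v1 @ v2) + 1" using u v by (auto simp: words_def)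
    have idx: "nat (j + int (trues u)) = ?i" "nat (j + 1 + int (trues u)) = Suc ?i"
        "nat (j + 2 + int (trues u)) = Suc (Suc ?i)"
      by (simp_all add: j_def tr)
    have "trues (drop ?i u) = trues (drop (Suc ?i) u) + 1"
        "trues (drop (Suc (Suc ?i)) u) = trues (drop (Suc ?i) u)"
      using Aj unfolding A_def profile_def idx by linarith+
    with len trues_drop_Suc[of ?i u] trues_drop_Suc[of "Suc ?i" u]
    have "(if u ! ?i then 1 else 0 :: nat) = 1" "(if u ! Suc ?i then 1 else 0 :: nat) = 0"
      by linarith+
    then have "u ! ?i = True" "u ! Suc ?i = False" by (simp_all split: if_splits)
    then have "u = take ?i u @ True # False # drop (Suc (Suc ?i)) u"
      using len id_take_nth_drop[of ?i u] Cons_nth_drop_Suc[of "Suc ?i" u] by simp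
    moreover have "length (take ?i u) = ?i" using len by simp
    ultimately show ?thesis by blast
  qed
  have "tiling_number u (v1 @ True # False # v2) =
      tiling_number u (v1 @ False # True # v2) + (if B \<le> A then card S else 0)"
  proof (cases "B \<le> A")
    case True
    let ?C = "{\<T> \<in> ci_tilings (region A B). {valley_node B j} \<in> \<T>}"
    have "finite (region A B)"
      unfolding A_def B_def using u v by (intro finite_region_profile) (auto simp: words_def)
    then have fin: "finite (ci_tilings (region A B))" by (rule finite_ci_tilings)
    have "ci_tilings (region A B) = ?C \<union> S" by (auto simp: S_def)
    then have "card (ci_tilings (region A B)) = card ?C + card S"
      using fin by (subst card_Un_disjoint[symmetric]) (auto simp: S_def)
    moreover have "card ?C = tiling_number u (v1 @ False # True # v2)"
    proof (cases "B (j + 1) < A (j + 1)")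
      case less: True
      then show ?thesis
        using True B'le card_ci_tilings_valley_node[of B j A]
        by (simp add: tiling_number_def A_def[symmetric] B'_def[symmetric] B'_eq)
    next
      \<comment> \<open>Without room in the column the addable node is outside the region, and the
        path with FT no longer lies below \<open>u\<close>: both numbers vanish.\<close>
      case False
      have "valley_node B j \<notin> region A B"
        unfolding valley_node_def mem_region_col using False by simp
      then have "?C = {}" using ci_tilings_subset by blast
      then have "card ?C = 0" by (simp only: card.empty)
      moreover have "\<not> B' \<le> A" using B'le False by simp
      ultimately show ?thesis by (simp add: tiling_number_def A_def B'_def)
    qed
    ultimately show ?thesis using True by (simp add: tiling_number_def A_def B_def)
  next
    case False
    with B'le show ?thesis by (simp add: tiling_number_def A_def B_def B'_def)
  qed
  also have "(if B \<le> A then card S else 0) = (if \<exists>u1 u2. u = u1 @ True # False # u2 \<and> length u1 = length v1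
     then tiling_number (cut (length v1) u) (v1 @ v2) else 0)"
  proof (cases "\<exists>u1 u2. u = u1 @ True # False # u2 \<and> length u1 = length v1")
    case True
    then obtain u1 u2 where u12: "u = u1 @ True # False # u2" "length u1 = length v1" by blast
    moreover have "trues (u1 @ u2) = trues (v1 @ v2)" using u v u12 by (simp add: words_def)
    moreover have "cut (length v1) u = u1 @ u2"
      using u12(2)[symmetric] by (simp add: u12(1))
    ultimately show ?thesis
      using tiling_number_insert_valley[of u1 v1 u2 v2 j] True
      by (simp add: j_def A_def B_def S_def)
  next
    case False
    then have "S = {}" if "B \<le> A" using peak that by blast
    then have "(if B \<le> A then card S else 0) = 0" by simp
    then show ?thesis unfolding if_not_P[OF False] .
  qed
  finally show ?thesis .
qed

section \<open>Cup diagrams\<close>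

definition single :: "'b \<Rightarrow> 'b \<Rightarrow> 'a::comm_ring_1" where
  "single v = (\<lambda>w. if w = v then 1 else 0)"

text \<open>\<open>sact i\<close> is the action of \<open>s\<^sub>i\<^sub>+\<^sub>1\<close> (positions in a word start at 0), and \<open>cup i\<close> inserts
  \<open>TF - FT\<close> at position \<open>i\<close>.\<close>

definition flip :: "nat \<Rightarrow> bool list \<Rightarrow> bool list" where
  "flip i w = (if i + 2 \<le> length w then take i w @ w ! Suc i # w ! i # drop (i + 2) w else w)"

definition sact :: "nat \<Rightarrow> (bool list \<Rightarrow> 'a::comm_ring_1) \<Rightarrow> bool list \<Rightarrow> 'a" where
  "sact i X = (\<lambda>w. X (flip i w) - X w)"

definition cup :: "nat \<Rightarrow> (bool list \<Rightarrow> 'a::comm_ring_1) \<Rightarrow> bool list \<Rightarrow> 'a" where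
  "cup i X = (\<lambda>w. if i + 2 \<le> length w \<and> w ! i \<noteq> w ! Suc i
     then (if w ! i then X (cut i w) else - X (cut i w)) else 0)"

lemma flip_append [simp]: "flip (length w1) (w1 @ a # b # w2) = w1 @ b # a # w2"
  by (simp add: flip_def nth_append)

lemma flip_short [simp]: "length w < i + 2 \<Longrightarrow> flip i w = w"
  by (simp add: flip_def)

lemma length_flip [simp]: "length (flip i w) = length w"
  by (auto simp: flip_def)

lemma cup_append [simp]: "cup (length w1) X (w1 @ a # b # w2) =
    (if a = b then 0 else if a then X (w1 @ w2) else - X (w1 @ w2))"
  by (simp add: cup_def nth_append)

lemma cup_short [simp]: "length w < i + 2 \<Longrightarrow> cup i X w = 0"
  by (simp add: cup_def)

lemma splitE:
  assumes "i + 2 \<le> length w"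
  obtains w1 a b w2 where "w = w1 @ a # b # w2" "length w1 = i"
proof
  show "w = take i w @ w ! i # w ! Suc i # drop (Suc (Suc i)) w"
    using assms id_take_nth_drop[of i w] Cons_nth_drop_Suc[of "Suc i" w] by simp
qed (use assms in simp)

lemma flip_flip [simp]: "flip i (flip i w) = w"
proof (cases "i + 2 \<le> length w")
  case True
  then obtain w1 a b w2 where "w = w1 @ a # b # w2" "length w1 = i" by (rule splitE)
  then show ?thesis by auto
qed simp

lemma split2E:
  assumes "i + 2 \<le> j" "j + 2 \<le> length w"
  obtains w1 a b w2 c d w3 where "w = w1 @ a # b # w2 @ c # d # w3" "i = length w1"
    "j = length (w1 @ a # b # w2)" "j - 2 = length (w1 @ w2)"
proof -
  obtain w1 a b w' where w: "w = w1 @ a # b # w'" "length w1 = i"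
    using assms by (elim splitE[of i w, rotated]) simp
  then have "j - i - 2 + 2 \<le> length w'" using assms by simp
  then obtain w2 c d w3 where w': "w' = w2 @ c # d # w3" "length w2 = j - i - 2"
    by (rule splitE)
  show thesis
  proof (rule that)
    show "w = w1 @ a # b # w2 @ c # d # w3" using w w' by simp
  qed (use assms w(2) w'(2) in simp_all)
qed

text \<open>Two factors of length two coincide, share one letter or are disjoint. This case split
  drives both inductions on cup diagrams.\<close>

lemma pair_positions:
  assumes "u1 @ a # b # u2 = v1 @ c # d # v2"
  shows "u1 = v1 \<and> a = c \<and> b = d \<and> u2 = v2 \<or>
    v1 = u1 @ [a] \<and> b = c \<and> u2 = d # v2 \<or> (\<exists>m. v1 = u1 @ a # b # m \<and> u2 = m @ c # d # v2) \<or>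
    u1 = v1 @ [c] \<and> d = a \<and> v2 = b # u2 \<or> (\<exists>m. u1 = v1 @ c # d # m \<and> v2 = m @ a # b # u2)"
proof -
  have aux: "us = [] \<and> a = c \<and> b = d \<and> u2 = v2 \<or> us = [a] \<and> b = c \<and> u2 = d # v2 \<or>
      (\<exists>m. us = a # b # m \<and> u2 = m @ c # d # v2)"
    if "a # b # u2 = us @ c # d # v2" for us a b u2 c d and v2 :: "'a list"
    using that by (cases us; cases "tl us") auto
  from assms obtain us where "u1 @ us = v1 \<and> a # b # u2 = us @ c # d # v2 \<or>
      u1 = v1 @ us \<and> c # d # v2 = us @ a # b # u2"
    unfolding append_eq_append_conv2 by metis
  then show ?thesis
  proof (elim disjE conjE)
    assume "u1 @ us = v1" "a # b # u2 = us @ c # d # v2"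
    with aux[OF this(2)] show ?thesis by auto
  next
    assume "u1 = v1 @ us" "c # d # v2 = us @ a # b # u2"
    with aux[OF this(2)] show ?thesis by auto
  qed
qed

lemma cup_single: "cup (length w1) (single (w1 @ w2)) w =
    single (w1 @ True # False # w2) w - single (w1 @ False # True # w2) w"
proof (cases "length w1 + 2 \<le> length w")
  case True
  then obtain x1 a b x2 where "w = x1 @ a # b # x2" "length x1 = length w1" by (rule splitE)
  then show ?thesis by (auto simp: single_def simp flip: \<open>length x1 = length w1\<close>)
next
  case False
  then show ?thesis by (auto simp: single_def)
qed

lemma cup_sum:
  fixes X :: "'b \<Rightarrow> bool list \<Rightarrow> 'a::comm_ring_1"
  shows "cup i (\<lambda>w. \<Sum>u\<in>U. c u * X u w) w = (\<Sum>u\<in>U. c u * cup i (X u) w)"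
proof (cases "i + 2 \<le> length w \<and> w ! i \<noteq> w ! Suc i")
  case True
  then show ?thesis by (simp add: cup_def sum_negf)
next
  case False
  then have "cup i Y w = 0" for Y :: "bool list \<Rightarrow> 'a"
    unfolding cup_def by (simp only: if_False)
  then show ?thesis by simp
qed

text \<open>Cups at disjoint places commute; deleting the left pair first moves the right pair two
  places to the left, hence j - 2.\<close>

lemma cup_cup:
  fixes X :: "bool list \<Rightarrow> 'a::comm_ring_1"
  assumes "i + 2 \<le> j"
  shows "cup j (cup i X) = cup i (cup (j - 2) X)"
proof
  fix w
  show "cup j (cup i X) w = cup i (cup (j - 2) X) w"
  proof (cases "j + 2 \<le> length w")
    case True
    with assms obtain w1 a b w2 c d w3 where w: "w = w1 @ a # b # w2 @ c # d # w3"
      and ij: "i = length w1" "j = length (w1 @ a # b # w2)" "j - 2 = length (w1 @ w2)"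
      by (rule split2E)
    have cj: "cup j Y w = (if c = d then 0 else if c then Y (w1 @ a # b # w2 @ w3) else - Y (w1 @ a # b # w2 @ w3))"
      for Y :: "bool list \<Rightarrow> 'a"
      unfolding w ij(2) using cup_append[of "w1 @ a # b # w2" Y c d w3] by simp
    have cj2: "cup (j - 2) Y (w1 @ w2 @ c # d # w3) =
        (if c = d then 0 else if c then Y (w1 @ w2 @ w3) else - Y (w1 @ w2 @ w3))"
      for Y :: "bool list \<Rightarrow> 'a"
      unfolding ij(3) using cup_append[of "w1 @ w2" Y c d w3] by simp
    have ci: "cup i Y (w1 @ a # b # z) = (if a = b then 0 else if a then Y (w1 @ z) else - Y (w1 @ z))"
      for Y :: "bool list \<Rightarrow> 'a" and z
      unfolding ij(1) by (rule cup_append)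
    show ?thesis unfolding cj unfolding w ci cj2 by simp
  next
    case False
    then have "cup (j - 2) X (cut i w) = 0" if "i + 2 \<le> length w"
      using assms that by (intro cup_short) (simp add: cut_def min_def)
    with False show ?thesis by (simp add: cup_def[of i])
  qed
qed

lemma sact_cup_right:
  fixes X :: "bool list \<Rightarrow> 'a::comm_ring_1"
  assumes "i + 2 \<le> j"
  shows "sact i (cup j X) = cup j (sact i X)"
proof
  fix w
  show "sact i (cup j X) w = cup j (sact i X) w"
  proof (cases "j + 2 \<le> length w")
    case True
    with assms obtain w1 a b w2 c d w3 where w: "w = w1 @ a # b # w2 @ c # d # w3"
      and ij: "i = length w1" "j = length (w1 @ a # b # w2)" by (rule split2E)
    have cp: "cup j Y (w1 @ x # y # w2 @ c # d # w3) =
        (if c = d then 0 else if c then Y (w1 @ x # y # w2 @ w3) else - Y (w1 @ x # y # w2 @ w3))"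
      for Y :: "bool list \<Rightarrow> 'a" and x y
      unfolding ij(2) using cup_append[of "w1 @ x # y # w2" Y c d w3] by simp
    show ?thesis unfolding sact_def unfolding w ij(1) flip_append
      unfolding cp ij(1)[symmetric] unfolding ij(1) flip_append by simp
  qed (simp add: sact_def)
qed

lemma sact_cup_left:
  fixes X :: "bool list \<Rightarrow> 'a::comm_ring_1"
  assumes "j + 2 \<le> i"
  shows "sact i (cup j X) = cup j (sact (i - 2) X)"
proof
  fix w
  show "sact i (cup j X) w = cup j (sact (i - 2) X) w"
  proof (cases "i + 2 \<le> length w")
    case True
    with assms obtain w1 a b w2 c d w3 where w: "w = w1 @ a # b # w2 @ c # d # w3"
      and ij: "j = length w1" "i = length (w1 @ a # b # w2)" "i - 2 = length (w1 @ w2)"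
      by (rule split2E)
    have "flip i w = w1 @ a # b # w2 @ d # c # w3"
      unfolding w ij(2) using flip_append[of "w1 @ a # b # w2" c d w3] by simp
    moreover have "flip (i - 2) (w1 @ w2 @ c # d # w3) = w1 @ w2 @ d # c # w3"
      unfolding ij(3) using flip_append[of "w1 @ w2" c d w3] by simp
    moreover have "cup j Y (w1 @ a # b # z) = (if a = b then 0 else if a then Y (w1 @ z) else - Y (w1 @ z))"
      for Y :: "bool list \<Rightarrow> 'a" and z
      unfolding ij(1) by (rule cup_append)
    ultimately show ?thesis unfolding sact_def w by simp
  next
    case False
    then have "flip (i - 2) (cut j w) = cut j w" if "j + 2 \<le> length w"
      using assms that by (intro flip_short) (simp add: cut_def min_def)
    with False show ?thesis by (auto simp: sact_def cup_def)
  qed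
qed

text \<open>Put e(T,F) = 1, e(F,T) = -1 and e = 0 on equal letters, and let X(x) be the value of X
  when only x is left of three adjacent letters a, b, c. The claim is e(a,c) X(b) - e(a,b) X(c) =
  e(b,c) X(a): the alternating sum vanishes since two of three letters from a two-letter alphabet
  agree.\<close>

lemma sact_cup_Suc: "sact (Suc i) (cup i X) = cup (Suc i) X"
proof
  fix w
  show "sact (Suc i) (cup i X) w = cup (Suc i) X w"
  proof (cases "Suc i + 2 \<le> length w")
    case True
    then obtain w0 b c w2 where w0: "w = w0 @ b # c # w2" "length w0 = Suc i" by (rule splitE)
    then obtain w1 a where w: "w0 = w1 @ [a]" "length w1 = i" by (metis length_Suc_conv_rev)
    have cp: "cup i X (w1 @ x # y # z) = (if x = y then 0 else if x then X (w1 @ z) else - X (w1 @ z))"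
      for x y z
      using w(2) by auto
    have cp': "cup (Suc i) X (w1 @ a # b # c # w2) =
        (if b = c then 0 else if b then X (w1 @ a # w2) else - X (w1 @ a # w2))"
      using cup_append[of w0 X b c w2] w0 w by simp
    have fl: "flip (Suc i) (w1 @ a # b # c # w2) = w1 @ a # c # b # w2"
      using flip_append[of w0 b c w2] w0 w by simp
    show ?thesis unfolding w0(1) w(1) sact_def append.assoc append_Cons append_Nil fl cp cp' by auto
  qed (simp add: sact_def)
qed

text \<open>The mirror image of \<open>sact_cup_Suc\<close>, from the same three-term identity. On
  words of length i + 2 there is no room for a cup at i + 1, while the right side reads X on a word
  of length i; \<open>supp\<close> makes this value zero.\<close>

lemma sact_cup_pred:
  assumes supp: "\<And>w. length w \<le> i \<Longrightarrow> X w = 0"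
  shows "sact i (cup (Suc i) X) = cup i X"
proof
  fix w
  show "sact i (cup (Suc i) X) w = cup i X w"
  proof (cases "Suc i + 2 \<le> length w")
    case True
    then obtain w0 b c w2 where w0: "w = w0 @ b # c # w2" "length w0 = Suc i" by (rule splitE)
    then obtain w1 a where w: "w0 = w1 @ [a]" "length w1 = i" by (metis length_Suc_conv_rev)
    have cp: "cup i X (w1 @ x # y # z) = (if x = y then 0 else if x then X (w1 @ z) else - X (w1 @ z))"
      for x y z
      using w(2) by auto
    have cp': "cup (Suc i) X (w1 @ x # y # z # w2) =
        (if y = z then 0 else if y then X (w1 @ x # w2) else - X (w1 @ x # w2))" for x y z
      using cup_append[of "w1 @ [x]" X y z w2] w by simp
    have fl: "flip i (w1 @ a # b # c # w2) = w1 @ b # a # c # w2"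
      using w by auto
    show ?thesis unfolding w0(1) w(1) sact_def append.assoc append_Cons append_Nil fl cp cp' by auto
  next
    case False
    then have "i + 2 \<le> length w \<Longrightarrow> X (cut i w) = 0"
      by (intro supp) (simp add: cut_def min_def)
    with False show ?thesis by (auto simp: sact_def cup_def)
  qed
qed

section \<open>The cup diagram of a word and the action of the generators\<close>

lemma not_sortedE:
  fixes u :: "bool list"
  assumes "\<not> sorted u"
  obtains u1 u2 where "u = u1 @ True # False # u2"
proof -
  from assms obtain i where i: "Suc i < length u" "u ! i" "\<not> u ! Suc i"
    by (auto simp: sorted_iff_nth_Suc)
  then have "u = take i u @ True # False # drop (Suc (Suc i)) u"
    using id_take_nth_drop[of i u] Cons_nth_drop_Suc[of "Suc i" u] by simp
  with that show thesis by blast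
qed

lemma not_sorted_append [simp]: "\<not> sorted (u1 @ True # False # u2)"
  by (simp add: sorted_append)

definition valley :: "bool list \<Rightarrow> nat" where
  "valley u = (SOME i. \<exists>u1 u2. u = u1 @ True # False # u2 \<and> length u1 = i)"

lemma valley:
  assumes "\<not> sorted u"
  obtains u1 u2 where "u = u1 @ True # False # u2" "length u1 = valley u"
proof -
  obtain u1 u2 where "u = u1 @ True # False # u2" using assms by (rule not_sortedE)
  then have "\<exists>i u1 u2. u = u1 @ True # False # u2 \<and> length u1 = i" by blast
  then have "\<exists>u1 u2. u = u1 @ True # False # u2 \<and> length u1 = valley u"
    unfolding valley_def by (rule someI_ex)
  with that show thesis by blast
qed

text \<open>Each deleted factor TF is an arc, and the sorted word that remains holds the unmatched
  letters. The factor is chosen arbitrarily by \<open>valley\<close>;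
  \<open>canonical_valley\<close> shows that the choice does not matter.\<close>

function canonical :: "bool list \<Rightarrow> bool list \<Rightarrow> 'a::comm_ring_1" where
  "canonical u = (if sorted u then single u else cup (valley u) (canonical (cut (valley u) u)))"
  by auto
termination
proof (relation "measure length")
  fix u :: "bool list" assume "\<not> sorted u"
  then obtain u1 u2 where "u = u1 @ True # False # u2" "length u1 = valley u" by (rule valley)
  then show "(cut (valley u) u, u) \<in> measure length" by (simp add: cut_def)
qed simp

declare canonical.simps [simp del]

lemma canonical_sorted: "sorted u \<Longrightarrow> canonical u = single u"
  by (simp add: canonical.simps)

text \<open>A diamond argument: two distinct factors TF cannot overlap, so each survives deletion of
  the other. By induction both orders of deletion lead to the same smaller diagram, and the two cups
  commute.\<close>

lemma canonical_valley:
  "(canonical (u1 @ True # False # u2) :: _ \<Rightarrow> 'a::comm_ring_1) = cup (length u1) (canonical (u1 @ u2))"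
proof (induction "length (u1 @ u2)" arbitrary: u1 u2 rule: less_induct)
  case less
  let ?K = "canonical :: _ \<Rightarrow> _ \<Rightarrow> 'a"
  let ?u = "u1 @ True # False # u2"
  obtain v1 v2 where v: "?u = v1 @ True # False # v2" "length v1 = valley ?u"
    using valley[OF not_sorted_append] by metis
  have can: "?K ?u = cup (length v1) (?K (v1 @ v2))"
    using v(2) cut_append[of v1 True False v2] unfolding v(1)[symmetric]
    by (subst canonical.simps) simp
  from pair_positions[OF v(1)]
  consider "u1 = v1" "u2 = v2" | m where "v1 = u1 @ True # False # m" "u2 = m @ True # False # v2"
    | m where "u1 = v1 @ True # False # m" "v2 = m @ True # False # u2"
    by auto
  then show ?case
  proof cases
    case 1
    with can show ?thesis by simp
  next
    case (2 m)
    have "?K (v1 @ v2) = cup (length u1) (?K (u1 @ m @ v2))"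
      using less[of u1 "m @ v2"] 2 by simp
    moreover have "?K (u1 @ u2) = cup (length (u1 @ m)) (?K (u1 @ m @ v2))"
      using less[of "u1 @ m" v2] 2 by simp
    ultimately show ?thesis
      using can cup_cup[of "length u1" "length v1", where ?'a = 'a] 2 by simp
  next
    case (3 m)
    have "?K (v1 @ v2) = cup (length (v1 @ m)) (?K (v1 @ m @ u2))"
      using less[of "v1 @ m" u2] 3 by simp
    moreover have "?K (u1 @ u2) = cup (length v1) (?K (v1 @ m @ u2))"
      using less[of v1 "m @ u2"] 3 by simp
    ultimately show ?thesis
      using can cup_cup[of "length v1" "length u1", where ?'a = 'a] 3 by simp
  qed
qed

text \<open>Supplies the support hypothesis of \<open>sact_cup_pred\<close>.\<close>

lemma canonical_support: "length w \<noteq> length u \<Longrightarrow> canonical u w = (0 :: 'a::comm_ring_1)"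
proof (induction "length u" arbitrary: u w rule: less_induct)
  case less
  let ?K = "canonical :: _ \<Rightarrow> _ \<Rightarrow> 'a"
  show ?case
  proof (cases "sorted u")
    case True
    with less.prems show ?thesis by (auto simp: canonical_sorted single_def)
  next
    case False
    then obtain u1 u2 where u: "u = u1 @ True # False # u2" by (rule not_sortedE)
    have "?K (u1 @ u2) (cut (length u1) w) = 0" if "length u1 + 2 \<le> length w"
      using less.prems that u by (intro less.hyps) (auto simp: cut_def)
    then show ?thesis unfolding u canonical_valley by (simp add: cup_def)
  qed
qed

text \<open>For a sorted word the result is TF - FT by direct computation. Otherwise some factor TF
  of the word is deleted: if it shares a letter with the given FT, a zigzag relation applies; if it
  is disjoint from it, s_i moves past the cup and the induction hypothesis applies.\<close>

lemma sact_canonical: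
  "sact (length u1) (canonical (u1 @ False # True # u2) :: _ \<Rightarrow> 'a::comm_ring_1) =
    canonical (u1 @ True # False # u2)"
proof (induction "length (u1 @ u2)" arbitrary: u1 u2 rule: less_induct)
  case less
  let ?K = "canonical :: _ \<Rightarrow> _ \<Rightarrow> 'a"
  let ?u = "u1 @ False # True # u2"
  show ?case
  proof (cases "sorted ?u")
    case True
    then have "sorted (u1 @ u2)" by (auto simp: sorted_append)
    then have "?K (u1 @ True # False # u2) = cup (length u1) (single (u1 @ u2))"
      by (simp add: canonical_valley canonical_sorted)
    moreover have "single ?u (flip (length u1) w) = (single (u1 @ True # False # u2) w :: 'a)" for w
      by (auto simp: single_def) (metis flip_append flip_flip)
    ultimately show ?thesis
      unfolding canonical_sorted[OF True] by (simp add: sact_def cup_single fun_eq_iff)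
  next
    case False
    then obtain v1 v2 where v: "?u = v1 @ True # False # v2" by (rule not_sortedE)
    have can: "?K ?u = cup (length v1) (?K (v1 @ v2))"
      unfolding v by (rule canonical_valley)
    from pair_positions[OF v]
    consider "v1 = u1 @ [False]" "u2 = False # v2"
      | m where "v1 = u1 @ False # True # m" "u2 = m @ True # False # v2"
      | "u1 = v1 @ [True]" "v2 = True # u2"
      | m where "u1 = v1 @ True # False # m" "v2 = m @ False # True # u2"
      by auto
    then show ?thesis
    proof cases
      case 1
      have "sact (length u1) (cup (Suc (length u1)) (?K (v1 @ v2))) = cup (length u1) (?K (v1 @ v2))"
        using 1 by (intro sact_cup_pred canonical_support) simp
      moreover have "length v1 = Suc (length u1)" "v1 @ v2 = u1 @ u2" using 1 by simp_all
      ultimately show ?thesis unfolding can canonical_valley by simp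
    next
      case (2 m)
      then have "length (u1 @ m @ v2) < length (u1 @ u2)" by simp
      from less.hyps[OF this] have sm: "sact (length u1) (?K (v1 @ v2)) =
          cup (length u1) (?K (u1 @ m @ v2))"
        unfolding canonical_valley 2 by simp
      have i: "length v1 - 2 = length (u1 @ m)" "length u1 + 2 \<le> length v1" using 2 by simp_all
      have "sact (length u1) (?K ?u) = cup (length v1) (cup (length u1) (?K (u1 @ m @ v2)))"
        unfolding can sact_cup_right[OF i(2)] sm ..
      also have "\<dots> = cup (length u1) (cup (length (u1 @ m)) (?K (u1 @ m @ v2)))"
        unfolding cup_cup[OF i(2)] i(1) ..
      also have "cup (length (u1 @ m)) (?K (u1 @ m @ v2)) = ?K (u1 @ u2)"
        using canonical_valley[of "u1 @ m" v2, where ?'a = 'a] 2 by simp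
      finally show ?thesis unfolding canonical_valley .
    next
      case 3
      then have i: "length u1 = Suc (length v1)" "v1 @ v2 = u1 @ u2" by simp_all
      show ?thesis unfolding can canonical_valley unfolding i by (rule sact_cup_Suc)
    next
      case (4 m)
      then have "length ((v1 @ m) @ u2) < length (u1 @ u2)" by simp
      from less.hyps[OF this] have sm: "sact (length (v1 @ m)) (?K (v1 @ v2)) =
          cup (length (v1 @ m)) (?K (v1 @ m @ u2))"
        unfolding canonical_valley 4 by simp
      have i: "length u1 - 2 = length (v1 @ m)" "length v1 + 2 \<le> length u1" using 4 by simp_all
      have "sact (length u1) (?K ?u) = cup (length v1) (cup (length (v1 @ m)) (?K (v1 @ m @ u2)))"
        unfolding can sact_cup_left[OF i(2)] i(1) sm ..
      also have "\<dots> = cup (length u1) (cup (length v1) (?K (v1 @ m @ u2)))"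
        unfolding cup_cup[OF i(2)] i(1) ..
      also have "cup (length v1) (?K (v1 @ m @ u2)) = ?K (u1 @ u2)"
        using canonical_valley[of v1 "m @ u2", where ?'a = 'a] 4 by simp
      finally show ?thesis unfolding canonical_valley .
    qed
  qed
qed

section \<open>Expansion of words in cup diagrams\<close>

text \<open>The induction measure: each letter counts one, and each True also counts the letters
  after it. It must drop both when TF becomes FT, with the length unchanged, and when TF is
  deleted.\<close>

fun weight :: "bool list \<Rightarrow> nat" where
  "weight [] = 0"
| "weight (x # u) = (if x then length u else 0) + weight u + 1"

lemma weight_flip: "weight (u1 @ False # True # u2) < weight (u1 @ True # False # u2)"
  by (induction u1) auto

lemma weight_delete: "weight (u1 @ u2) < weight (u1 @ True # False # u2)"
  by (induction u1) auto

lemma words_length: "u \<in> words f g \<Longrightarrow> length u = f + g"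
  by (simp add: words_def)

lemma trues_eq_0D: "trues u = 0 \<Longrightarrow> u = replicate (length u) False"
  by (induction u) (auto split: if_splits)

lemma trues_eq_lengthD: "trues u = length u \<Longrightarrow> u = replicate (length u) True"
proof (induction u)
  case (Cons x u)
  then show ?case using trues_le_length[of u] by (auto split: if_splits)
qed simp

lemma sorted_words:
  assumes "u \<in> words f g" "sorted u"
  shows "u = replicate f False @ replicate g True"
proof -
  have "u = replicate (length u - trues u) False @ replicate (trues u) True"
    using assms(2)
  proof (induction u)
    case (Cons x u)
    show ?case
    proof (cases x)
      case True
      with Cons.prems have "set u \<subseteq> {True}" by auto
      then have "u = replicate (length u) True" by (intro replicate_eqI) auto
      moreover from this have "trues u = length u" by (metis trues_simps(5))
      ultimately show ?thesis using True by simp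
    next
      case False
      with Cons show ?thesis
        using trues_le_length[of u] by (simp add: Suc_diff_le)
    qed
  qed simp
  with assms(1) show ?thesis by (simp add: words_def)
qed

text \<open>The sorted word is the path of the full rectangle, which only the rectangle itself
  contains; the empty region has exactly one tiling.\<close>

lemma tiling_number_sorted:
  assumes u: "u \<in> words f g" and v: "v \<in> words f g" "sorted v"
  shows "tiling_number u v = (if u = v then 1 else 0)"
proof (cases "u = v")
  case True
  have "region (profile v) (profile v) = {}" by (auto simp: region_def)
  with True show ?thesis by (simp add: tiling_number_def ci_tilings_empty)
next
  case False
  have "\<not> profile v \<le> profile u"
  proof
    assume "profile v \<le> profile u"
    \<comment> \<open>Column f - g is position f, the corner between the two blocks of the sorted
      word. There the profile reaches g only if all letters True of \<open>u\<close> come after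
      position f.\<close>
    then have "profile v (int f - int g) \<le> profile u (int f - int g)" by (rule le_funD)
    moreover have "v = replicate f False @ replicate g True" by (rule sorted_words[OF v])
    ultimately have "g \<le> trues (drop f u)" using u by (simp add: profile_def words_def)
    moreover have "trues (take f u) + trues (drop f u) = g"
      using u trues_simps(3)[of "take f u" "drop f u"] unfolding append_take_drop_id words_def by simp
    moreover have len: "length (take f u) = f" "length (drop f u) = g"
      using u by (simp_all add: words_def)
    ultimately have "trues (take f u) = 0" "trues (drop f u) = length (drop f u)"
      using trues_le_length[of "drop f u"] by linarith+
    then have "take f u = replicate f False" "drop f u = replicate g True"
      using trues_eq_0D[of "take f u"] trues_eq_lengthD[of "drop f u"] unfolding len by blast+
    then have "u = replicate f False @ replicate g True" by (metis append_take_drop_id)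
    with False sorted_words[OF v] show False by simp
  qed
  with False show ?thesis by (simp add: tiling_number_def)
qed

lemma bij_betw_insert_valley:
  assumes "i \<le> f + g"
  shows "bij_betw (\<lambda>u. take i u @ True # False # drop i u) (words f g)
    {u \<in> words (Suc f) (Suc g). \<exists>u1 u2. u = u1 @ True # False # u2 \<and> length u1 = i}"
    (is "bij_betw ?h _ ?V")
proof (rule bij_betw_byWitness[where f' = "cut i"])
  have len: "length (take i u) = i" if "u \<in> words f g" for u
    using that assms by (simp add: words_def)
  show "\<forall>u\<in>words f g. cut i (?h u) = u"
    using len cut_append by (metis append_take_drop_id)
  have "?h u \<in> ?V" if u: "u \<in> words f g" for u
  proof -
    have "trues (take i u) + trues (drop i u) = trues u"
      using trues_simps(3)[of "take i u" "drop i u"] by simp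
    then have "?h u \<in> words (Suc f) (Suc g)" using u len[OF u] by (simp add: words_def)
    with len[OF u] show ?thesis by blast
  qed
  then show "?h ` words f g \<subseteq> ?V" by blast
  have "cut i u \<in> words f g \<and> ?h (cut i u) = u" if u: "u \<in> ?V" for u
  proof -
    obtain u1 u2 where u12: "u = u1 @ True # False # u2" "i = length u1" using u by blast
    have "u \<in> words (Suc f) (Suc g)" using u by blast
    then show ?thesis unfolding u12 cut_append by (simp add: words_def)
  qed
  then show "\<forall>u\<in>?V. ?h (cut i u) = u" "cut i ` ?V \<subseteq> words f g" by blast+
qed

text \<open>By \<open>cup_single\<close>, \<open>v\<close> is the word with FT plus a cup over the
  shorter word. Both have smaller weight, and inserting TF at the position fixed by \<open>v\<close>
  turns the diagrams of the shorter words into those with TF at that position.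
  \<open>tiling_number_rec\<close> says that the coefficients add up accordingly.\<close>

theorem single_expansion:
  assumes "v \<in> words f g"
  shows "(single v w :: 'a::comm_ring_1) =
    (\<Sum>u\<in>words f g. of_nat (tiling_number u v) * canonical u w)"
  using assms
proof (induction "weight v" arbitrary: v f g w rule: less_induct)
  case less
  let ?K = "canonical :: _ \<Rightarrow> _ \<Rightarrow> 'a"
  show ?case
  proof (cases "sorted v")
    case True
    have "(\<Sum>u\<in>words f g. of_nat (tiling_number u v) * ?K u w) =
        (\<Sum>u\<in>words f g. if u = v then ?K v w else 0)"
      by (intro sum.cong) (auto simp: tiling_number_sorted[OF _ less.prems True])
    also have "\<dots> = single v w"
      using less.prems by (simp add: finite_words canonical_sorted[OF True])
    finally show ?thesis ..
  next
    case False
    then obtain v1 v2 where v: "v = v1 @ True # False # v2" by (rule not_sortedE)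
    define v' where "v' = v1 @ False # True # v2"
    let ?i = "length v1"
    have "trues v = Suc (trues (v1 @ v2))" "length v = Suc (Suc (length (v1 @ v2)))"
      using v by simp_all
    then have "f \<noteq> 0" "g \<noteq> 0"
      using less.prems trues_le_length[of "v1 @ v2"] by (auto simp: words_def)
    then obtain f' g' where fg: "f = Suc f'" "g = Suc g'" by (metis not0_implies_Suc)
    have v'w: "v' \<in> words f g" and vw: "v1 @ v2 \<in> words f' g'"
      using less.prems by (simp_all add: v v'_def words_def fg)
    let ?V = "{u \<in> words f g. \<exists>u1 u2. u = u1 @ True # False # u2 \<and> length u1 = ?i}"
    let ?h = "\<lambda>u. take ?i u @ True # False # drop ?i u"
    have i: "?i \<le> f' + g'" using words_length[OF vw] by simp
    have "(\<Sum>u\<in>words f g. of_nat (tiling_number u v) * ?K u w) =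
        (\<Sum>u\<in>words f g. of_nat (tiling_number u v') * ?K u w + (if u \<in> ?V
          then of_nat (tiling_number (cut ?i u) (v1 @ v2)) * ?K u w else 0))"
    proof (rule sum.cong)
      fix u assume u: "u \<in> words f g"
      show "of_nat (tiling_number u v) * ?K u w = of_nat (tiling_number u v') * ?K u w + (if u \<in> ?V
          then of_nat (tiling_number (cut ?i u) (v1 @ v2)) * ?K u w else 0)"
      proof (cases "\<exists>u1 u2. u = u1 @ True # False # u2 \<and> length u1 = ?i")
        case True
        with u have V: "u \<in> ?V" by blast
        then show ?thesis
          unfolding v tiling_number_rec[OF u[unfolded fg] vw] v'_def if_P[OF True] if_P[OF V]
          by (simp add: distrib_right)
      next
        case False
        then have V: "u \<notin> ?V" by blast
        then show ?thesis
          unfolding v tiling_number_rec[OF u[unfolded fg] vw] v'_def if_not_P[OF False] if_not_P[OF V] by simp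
      qed
    qed simp
    also have "\<dots> = (\<Sum>u\<in>words f g. of_nat (tiling_number u v') * ?K u w) +
        (\<Sum>u\<in>?V. of_nat (tiling_number (cut ?i u) (v1 @ v2)) * ?K u w)"
      unfolding sum.distrib by (subst sum.inter_restrict[OF finite_words, symmetric]) (simp add: Int_absorb1 subset_iff)
    also have "(\<Sum>u\<in>words f g. of_nat (tiling_number u v') * ?K u w) = single v' w"
      using less.hyps[OF _ v'w] weight_flip by (simp add: v v'_def)
    also have "(\<Sum>u\<in>?V. of_nat (tiling_number (cut ?i u) (v1 @ v2)) * ?K u w) =
        (\<Sum>u\<in>words f' g'. of_nat (tiling_number (cut ?i (?h u)) (v1 @ v2)) * ?K (?h u) w)"
      using sum.reindex_bij_betw[OF bij_betw_insert_valley[OF i], symmetric,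
          of "\<lambda>u. of_nat (tiling_number (cut ?i u) (v1 @ v2)) * ?K u w"]
      unfolding fg .
    also have "\<dots> = (\<Sum>u\<in>words f' g'. of_nat (tiling_number u (v1 @ v2)) * cup ?i (?K u) w)"
    proof (rule sum.cong)
      fix u assume "u \<in> words f' g'"
      then have len: "length (take ?i u) = ?i" using i by (simp add: words_def)
      have "cut ?i (?h u) = u" using cut_append[of "take ?i u"] unfolding len by simp
      moreover have "?K (?h u) = cup ?i (?K u)"
        using canonical_valley[of "take ?i u" "drop ?i u", where ?'a = 'a] unfolding len by simp
      ultimately show "of_nat (tiling_number (cut ?i (?h u)) (v1 @ v2)) * ?K (?h u) w =
          of_nat (tiling_number u (v1 @ v2)) * cup ?i (?K u) w" by simp
    qed simp
    also have "\<dots> = cup ?i (single (v1 @ v2)) w"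
    proof -
      have "single (v1 @ v2) = (\<lambda>w. \<Sum>u\<in>words f' g'. of_nat (tiling_number u (v1 @ v2)) * ?K u w)"
        using less.hyps[OF _ vw] weight_delete by (auto simp: v)
      then show ?thesis by (simp add: cup_sum)
    qed
    also have "single v' w + cup ?i (single (v1 @ v2)) w = single v w"
      unfolding cup_single by (simp add: v v'_def)
    finally show ?thesis ..
  qed
qed

section \<open>Boundary paths of partitions\<close>

text \<open>The parts after the first fit into a box of width l, so the recursive call narrows the
  width to l. The path is read from the smallest part on; the first part contributes the last
  True.\<close>

fun path :: "nat \<Rightarrow> nat list \<Rightarrow> bool list" where
  "path f [] = replicate f False"
| "path f (l # lam) = path l lam @ True # replicate (f - l) False"

lemma Pfg_Nil: "[] \<in> Pfg f 0"
  by (simp add: Pfg_def)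

lemma Pfg_Cons: "l # lam \<in> Pfg f (Suc g) \<longleftrightarrow> l \<le> f \<and> lam \<in> Pfg l g"
  by (auto simp: Pfg_def)

lemma Pfg_mono: "lam \<in> Pfg l g \<Longrightarrow> l \<le> f \<Longrightarrow> lam \<in> Pfg f g"
  by (auto simp: Pfg_def)

lemma Pfg_length: "lam \<in> Pfg f g \<Longrightarrow> length lam = g"
  by (simp add: Pfg_def)

lemma path_in_words: "lam \<in> Pfg f g \<Longrightarrow> path f lam \<in> words f g"
proof (induction lam arbitrary: f g)
  case Nil
  then show ?case by (simp add: Pfg_def words_def)
next
  case (Cons l lam)
  then obtain g' where g: "g = Suc g'" by (auto simp: Pfg_def)
  with Cons.prems have "l \<le> f" "lam \<in> Pfg l g'" by (simp_all add: Pfg_Cons)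
  with Cons.IH[OF this(2)] show ?case by (simp add: g words_def)
qed

lemma path_extend:
  assumes "lam \<in> Pfg l g" "l \<le> f"
  shows "path f lam = path l lam @ replicate (f - l) False"
proof (cases lam)
  case Nil
  then show ?thesis using assms by (simp flip: replicate_add)
next
  case (Cons m lam')
  then have "m \<le> l" using assms by (auto simp: Pfg_def)
  then show ?thesis using assms Cons by (simp flip: replicate_add)
qed

lemma append_True_replicate_eq:
  "u @ True # replicate m False = v @ True # replicate n False \<longleftrightarrow> u = v \<and> m = n"
proof
  assume eq: "u @ True # replicate m False = v @ True # replicate n False"
  have tw: "takeWhile Not (rev (w @ True # replicate k False)) = replicate k False" for w k
    by (simp add: takeWhile_append)
  from tw[of u m] tw[of v n] have "m = n" unfolding eq by (metis length_replicate)
  with eq show "u = v \<and> m = n" by simp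
qed simp

lemma inj_on_path: "inj_on (path f) (Pfg f g)"
proof (rule inj_onI)
  show "lam = mu" if "lam \<in> Pfg f g" "mu \<in> Pfg f g" "path f lam = path f mu" for lam mu
    using that
  proof (induction lam arbitrary: mu f g)
    case Nil
    then show ?case by (simp add: Pfg_def)
  next
    case (Cons l lam)
    then obtain m mu' g' where mu: "mu = m # mu'" "g = Suc g'" by (cases mu) (auto simp: Pfg_def)
    with Cons.prems have le: "l \<le> f" "lam \<in> Pfg l g'" "m \<le> f" "mu' \<in> Pfg m g'"
      by (simp_all add: Pfg_Cons)
    from Cons.prems(3) have "path l lam = path m mu'" "f - l = f - m"
      unfolding mu path.simps append_True_replicate_eq by simp_all
    with le have "l = m" by simp
    with Cons.IH[OF le(2)] le \<open>path l lam = path m mu'\<close> show ?case by (simp add: mu)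
  qed
qed

lemma last_TrueE:
  assumes "trues u \<noteq> 0"
  obtains u' n where "u = u' @ True # replicate n False"
proof -
  have "\<exists>u' n. u = u' @ True # replicate n False"
    using assms
  proof (induction u rule: rev_induct)
    case (snoc x u)
    show ?case
    proof (cases x)
      case True
      then show ?thesis by (intro exI[of _ u] exI[of _ 0]) simp
    next
      case False
      with snoc obtain u' n where "u = u' @ True # replicate n False" by auto
      then show ?thesis using False
        by (intro exI[of _ u'] exI[of _ "Suc n"]) (simp add: replicate_append_same)
    qed
  qed simp
  with that show thesis by blast
qed

lemma path_surj: "u \<in> words f g \<Longrightarrow> \<exists>lam\<in>Pfg f g. u = path f lam"
proof (induction g arbitrary: f u)
  case 0
  then have "u = replicate f False" using trues_eq_0D[of u] by (simp add: words_def)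
  then show ?case using Pfg_Nil by force
next
  case (Suc g)
  then have "trues u \<noteq> 0" by (simp add: words_def)
  then obtain u' n where u: "u = u' @ True # replicate n False" by (rule last_TrueE)
  with Suc.prems have "n \<le> f" "u' \<in> words (f - n) g"
    using trues_le_length[of u'] by (auto simp: words_def)
  with Suc.IH[of u' "f - n"] obtain lam where "lam \<in> Pfg (f - n) g" "u' = path (f - n) lam" by blast
  with u \<open>n \<le> f\<close> show ?case
    by (intro bexI[of _ "(f - n) # lam"]) (simp_all add: Pfg_Cons)
qed

lemma bij_betw_path: "bij_betw (path f) (Pfg f g) (words f g)"
proof (rule bij_betw_imageI)
  show "path f ` Pfg f g = words f g" using path_in_words path_surj by fast
qed (rule inj_on_path)

lemma part_Cons: "part (l # lam) r = (if r = 1 then l else part lam (r - 1))"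
  by (cases r) (auto simp: part_def nth_Cons' )

lemma part_le: "lam \<in> Pfg f g \<Longrightarrow> part lam r \<le> f"
  by (auto simp: part_def Pfg_def)

text \<open>The profile sees the rows 1 to g prolonged to the left without end, as b may be zero or
  negative. These extra nodes are common to all partitions in the box and cancel in differences of
  diagrams.\<close>

lemma le_profile_path:
  assumes "lam \<in> Pfg f g" "1 \<le> a"
  shows "a \<le> profile (path f lam) (b - a) \<longleftrightarrow> a \<le> int g \<and> b \<le> int (part lam (nat a))"
  using assms
proof (induction lam arbitrary: f g a)
  case Nil
  then show ?case by (simp add: Pfg_def profile_def)
next
  case (Cons l lam)
  then obtain g' where g: "g = Suc g'" by (auto simp: Pfg_def)
  with Cons.prems have le: "l \<le> f" and lam: "lam \<in> Pfg l g'" by (simp_all add: Pfg_Cons)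
  have len: "length (path l lam) = l + g'" "trues (path l lam) = g'"
    using path_in_words[OF lam] by (simp_all add: words_def)
  define p where "p = b - a + int g"
  have prof: "profile (path f (l # lam)) (b - a) =
      int (trues (drop (nat p) (path l lam @ True # replicate (f - l) False)))"
    by (simp add: profile_def p_def g len algebra_simps)
  show ?case
  \<comment> \<open>Up to position l + g' the last True is still ahead and adds one to the count;
    the rest is the profile of the remaining parts, where row a becomes row a - 1. Beyond it only
    False is left.\<close>
  proof (cases "nat p \<le> l + g'")
    case True
    then have "profile (path f (l # lam)) (b - a) = profile (path l lam) (b - (a - 1)) + 1"
      unfolding prof by (simp add: profile_def p_def g len algebra_simps)
    moreover have "nat (a - 1) = nat a - 1" "nat a = 1 \<longleftrightarrow> a = 1" by auto
    moreover have "b \<le> int l" if "a = 1" using True that by (simp add: p_def g)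
    ultimately show ?thesis
      using Cons.IH[OF lam, of "a - 1"] Cons.prems(2) profile_nonneg[of "path l lam" "b - (a - 1)"]
      by (auto simp: g part_Cons)
  next
    case False
    then have "profile (path f (l # lam)) (b - a) = 0"
      unfolding prof using len trues_simps(4)[of "f - l - (nat p - Suc (l + g'))"]
      by (simp add: drop_Cons' not_le)
    moreover have "part (l # lam) (nat a) \<le> l"
      using part_le[OF lam] by (simp add: part_Cons)
    ultimately show ?thesis using Cons.prems(2) False by (auto simp: p_def g)
  qed
qed

lemma le_profile_path':
  assumes "lam \<in> Pfg f g" "1 \<le> a"
  shows "a \<le> profile (path f lam) c \<longleftrightarrow> a \<le> int g \<and> a + c \<le> int (part lam (nat a))"
  using le_profile_path[OF assms, of "a + c"] by simp

lemma mem_diagram: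
  assumes "lam \<in> Pfg f g"
  shows "(a, b) \<in> diagram lam \<longleftrightarrow> 1 \<le> a \<and> 1 \<le> b \<and> a \<le> profile (path f lam) (b - a)"
proof -
  have "a \<le> int g" if "1 \<le> b" "b \<le> int (part lam (nat a))"
    using that assms by (auto simp: part_def Pfg_length split: if_splits)
  then show ?thesis
    using le_profile_path[OF assms] by (auto simp: diagram_def)
qed

lemma diagram_subset_iff:
  assumes "lam \<in> Pfg f g" "mu \<in> Pfg f g"
  shows "diagram mu \<subseteq> diagram lam \<longleftrightarrow> profile (path f mu) \<le> profile (path f lam)"
proof
  assume sub: "diagram mu \<subseteq> diagram lam"
  have "profile (path f mu) c \<le> profile (path f lam) c" for c
  proof (cases "1 \<le> profile (path f mu) c")
    case True
    define a where "a = profile (path f mu) c"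
    have a: "1 \<le> a" "a \<le> int g" "a + c \<le> int (part mu (nat a))"
      using True le_profile_path'[OF assms(2), of a c] by (simp_all add: a_def)
    show ?thesis
    proof (cases "1 \<le> a + c")
      case True
      with a have "(a, a + c) \<in> diagram mu" by (simp add: mem_diagram[OF assms(2)] a_def)
      with sub have "(a, a + c) \<in> diagram lam" by blast
      then show ?thesis by (simp add: mem_diagram[OF assms(1)] a_def)
    next
      case False
      \<comment> \<open>The node lies left of the first diagram column, where the bound by a part
        holds trivially.\<close>
      then have "a + c \<le> int (part lam (nat a))" by simp
      with a show ?thesis
        using le_profile_path'[OF assms(1), of a c] by (simp add: a_def)
    qed
  next
    case False
    then show ?thesis using profile_nonneg[of "path f lam" c] by simp
  qed
  then show "profile (path f mu) \<le> profile (path f lam)" by (rule le_funI)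
next
  assume le: "profile (path f mu) \<le> profile (path f lam)"
  show "diagram mu \<subseteq> diagram lam"
  proof clarify
    fix a b assume "(a, b) \<in> diagram mu"
    then show "(a, b) \<in> diagram lam"
      using le_funD[OF le, of "b - a"] by (auto simp: mem_diagram[OF assms(1)] mem_diagram[OF assms(2)])
  qed
qed

lemma diagram_diff_eq_region:
  assumes "lam \<in> Pfg f g" "mu \<in> Pfg f g"
  shows "diagram lam - diagram mu = region (profile (path f lam)) (profile (path f mu))"
proof (intro set_eqI)
  fix n :: node
  obtain a b where n: "n = (a, b)" by (cases n)
  have "1 \<le> b" if *: "1 \<le> a" "a \<le> profile (path f lam) (b - a)" "profile (path f mu) (b - a) < a"
  proof (rule ccontr)
    assume "\<not> 1 \<le> b"
    then have "a \<le> profile (path f mu) (b - a)"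
      using * le_profile_path[OF assms(1), of a b] le_profile_path[OF assms(2), of a b] by simp
    with * show False by simp
  qed
  then show "n \<in> diagram lam - diagram mu \<longleftrightarrow>
      n \<in> region (profile (path f lam)) (profile (path f mu))"
    unfolding n Diff_iff mem_diagram[OF assms(1)] mem_diagram[OF assms(2)] region_def
    using profile_nonneg[of "path f mu" "b - a"] by auto
qed

lemma ici_eq_tiling_number:
  assumes "lam \<in> Pfg f g" "mu \<in> Pfg f g"
  shows "ici lam mu = tiling_number (path f lam) (path f mu)"
  unfolding ici_def tiling_number_def diagram_subset_iff[OF assms] diagram_diff_eq_region[OF assms]
    ci_tilings_def ..

text \<open>Reading \<open>is\<close> from the right, each adjacent transposition turns a factor \<open>FT\<close> into \<open>TF\<close>, starting from
  \<open>w\<close> and ending at \<open>u\<close>; the list indexes the generators from 1.\<close>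

fun raises :: "nat list \<Rightarrow> bool list \<Rightarrow> bool list \<Rightarrow> bool" where
  "raises [] w u \<longleftrightarrow> u = w"
| "raises (i # is) w u \<longleftrightarrow> (\<exists>u1 u2. raises is w (u1 @ False # True # u2) \<and>
     i = Suc (length u1) \<and> u = u1 @ True # False # u2)"

lemma raises_append_right: "raises is w u \<Longrightarrow> raises is (w @ z) (u @ z)"
proof (induction "is" arbitrary: u)
  case (Cons i "is")
  then obtain u1 u2 where "raises is w (u1 @ False # True # u2)" "i = Suc (length u1)"
    "u = u1 @ True # False # u2" by auto
  with Cons.IH[of "u1 @ False # True # u2"] show ?case
    by (simp, intro exI[of _ u1] exI[of _ "u2 @ z"]) simp
qed simp

lemma raises_append: "raises js w v \<Longrightarrow> raises is v u \<Longrightarrow> raises (is @ js) w u"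
  by (induction "is" arbitrary: u) auto

text \<open>One factor of the defining product: read from the right, its generators carry a single
  True leftwards across a block of n letters False.\<close>

lemma raises_move:
  "raises [Suc (length u)..<Suc (length u) + n] (u @ replicate n False @ True # z) (u @ True # replicate n False @ z)"
proof (induction n arbitrary: u)
  case (Suc n)
  have "raises [Suc (Suc (length u))..<Suc (Suc (length u)) + n]
      (u @ replicate (Suc n) False @ True # z) (u @ False # True # replicate n False @ z)"
    using Suc.IH[of "u @ [False]"] by simp
  then show ?case
    by (simp add: upt_rec[of "Suc (length u)"] del: upt_Suc)
      (intro exI[of _ u] exI[of _ "replicate n False @ z"], simp)
qed simp

lemma word_Cons: "word f (Suc g) (l # lam) = [l + g + 1..<f + g + 1] @ word f g lam"
proof -
  let ?F = "\<lambda>r. [part (l # lam) r + Suc g - r + 1..<f + Suc g - r + 1]"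
  have "[1..<Suc g + 1] = 1 # map Suc [1..<g + 1]"
    by (simp add: map_Suc_upt upt_conv_Cons del: upt_Suc)
  then have "word f (Suc g) (l # lam) = ?F 1 @ concat (map ?F (map Suc [1..<g + 1]))"
    unfolding word_def by (simp only: list.map concat.simps)
  also have "map ?F (map Suc [1..<g + 1]) =
      map (\<lambda>r. [part lam r + g - r + 1..<f + g - r + 1]) [1..<g + 1]"
    by (auto simp: part_Cons simp del: upt_Suc)
  also have "?F 1 = [l + g + 1..<f + g + 1]"
    by (simp add: part_Cons del: upt_Suc)
  finally show ?thesis unfolding word_def .
qed

text \<open>The factors of the later parts act first and leave the last True in place, behind f - l
  trailing letters False. The leftmost factor then moves this True across exactly that
  block.\<close>

lemma raises_word:
  "lam \<in> Pfg f g \<Longrightarrow> raises (word f g lam) (replicate f False @ replicate g True) (path f lam)"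
proof (induction lam arbitrary: g)
  case Nil
  then show ?case by (simp add: Pfg_def word_def)
next
  case (Cons l lam)
  then obtain g' where g: "g = Suc g'" by (auto simp: Pfg_def)
  with Cons.prems have le: "l \<le> f" and lam: "lam \<in> Pfg l g'" by (simp_all add: Pfg_Cons)
  have len: "length (path l lam) = l + g'"
    using path_in_words[OF lam] by (simp add: words_def)
  have "raises (word f g' lam) (replicate f False @ replicate g True) (path f lam @ [True])"
    using raises_append_right[OF Cons.IH[OF Pfg_mono[OF lam le]], of "[True]"]
    by (simp add: g replicate_append_same)
  moreover have "raises [l + g' + 1..<f + g' + 1] (path f lam @ [True]) (path f (l # lam))"
    using raises_move[of "path l lam" "f - l" "[]"] le
    by (simp add: path_extend[OF lam le] len algebra_simps del: upt_Suc)
  ultimately show ?case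
    unfolding g word_Cons by (rule raises_append)
qed

section \<open>The permutation module\<close>

lemma finite_perms: "finite (perms k)"
  by (simp add: perms_def finite_permutations)

lemma perms_comp: "\<sigma> \<in> perms k \<Longrightarrow> \<tau> \<in> perms k \<Longrightarrow> \<sigma> \<circ> \<tau> \<in> perms k"
  by (simp add: perms_def permutes_compose)

lemma perms_id: "id \<in> perms k"
  by (simp add: perms_def permutes_id)

lemma perms_transpose: "1 \<le> a \<Longrightarrow> a \<le> k \<Longrightarrow> 1 \<le> b \<Longrightarrow> b \<le> k \<Longrightarrow> transpose a b \<in> perms k"
  by (simp add: perms_def permutes_swap_id)

lemma gmult_delta_left:
  assumes \<tau>: "\<tau> \<in> perms k" and x: "x \<in> galg k"
  shows "gmult k (delta \<tau>) x \<sigma> = x (inv \<tau> \<circ> \<sigma>)"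
proof -
  have bij: "bij \<tau>" using \<tau> by (simp add: perms_def permutes_bij)
  have "gmult k (delta \<tau>) x \<sigma> = (\<Sum>\<pi>\<in>perms k. if \<pi> = \<tau> then
      (\<Sum>\<rho>\<in>perms k. if \<rho> = inv \<tau> \<circ> \<sigma> then x \<rho> else 0) else 0)"
    unfolding gmult_def
  proof (rule sum.cong)
    fix \<pi>
    have "\<tau> \<circ> \<rho> = \<sigma> \<longleftrightarrow> \<rho> = inv \<tau> \<circ> \<sigma>" for \<rho>
      using bij by (metis bij_is_inj bij_is_surj comp_assoc comp_id fun.map_id inv_o_cancel surj_iff id_comp)
    then show "(\<Sum>\<rho>\<in>perms k. if \<pi> \<circ> \<rho> = \<sigma> then delta \<tau> \<pi> * x \<rho> else 0) = (if \<pi> = \<tau> then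
      (\<Sum>\<rho>\<in>perms k. if \<rho> = inv \<tau> \<circ> \<sigma> then x \<rho> else 0) else 0)"
      by (auto simp: delta_def intro!: sum.cong sum.neutral)
  qed simp
  also have "\<dots> = (if inv \<tau> \<circ> \<sigma> \<in> perms k then x (inv \<tau> \<circ> \<sigma>) else 0)"
    using \<tau> by (simp add: finite_perms)
  also have "\<dots> = x (inv \<tau> \<circ> \<sigma>)"
    using x by (auto simp: galg_def)
  finally show ?thesis .
qed

lemma gmult_add_left: "gmult k (\<lambda>\<sigma>. x \<sigma> + y \<sigma>) z = (\<lambda>\<sigma>. gmult k x z \<sigma> + gmult k y z \<sigma>)"
  unfolding gmult_def sum.distrib[symmetric] by (intro ext sum.cong) (auto simp: distrib_right)

lemma gmult_diff_left: "gmult k (\<lambda>\<sigma>. x \<sigma> - y \<sigma>) z = (\<lambda>\<sigma>. gmult k x z \<sigma> - gmult k y z \<sigma>)"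
  unfolding gmult_def sum_subtractf[symmetric] by (intro ext sum.cong) (auto simp: left_diff_distrib)

lemma gmult_scale_left: "gmult k (\<lambda>\<sigma>. a * x \<sigma>) z = (\<lambda>\<sigma>. a * gmult k x z \<sigma>)"
  unfolding gmult_def sum_distrib_left by (intro ext sum.cong) (auto simp: mult.assoc)

lemma gmult_zero_left: "gmult k (\<lambda>\<sigma>. 0) z = (\<lambda>\<sigma>. 0)"
  unfolding gmult_def by (intro ext sum.neutral ballI) auto

lemma delta_galg: "\<sigma> \<in> perms k \<Longrightarrow> delta \<sigma> \<in> galg k"
  by (simp add: galg_def delta_def)

lemma galg_add: "x \<in> galg k \<Longrightarrow> y \<in> galg k \<Longrightarrow> (\<lambda>\<sigma>. x \<sigma> + y \<sigma>) \<in> galg k"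
  by (force simp: galg_def)

lemma galg_scale: "x \<in> galg k \<Longrightarrow> (\<lambda>\<sigma>. a * x \<sigma>) \<in> galg k"
  by (force simp: galg_def)

lemma galg_diff: "x \<in> galg k \<Longrightarrow> y \<in> galg k \<Longrightarrow> (\<lambda>\<sigma>. x \<sigma> - y \<sigma>) \<in> galg k"
  by (force simp: galg_def)

lemma tgen_galg: "1 \<le> i \<Longrightarrow> i < k \<Longrightarrow> tgen i \<in> galg k"
  unfolding tgen_def by (intro delta_galg perms_transpose) auto

lemma galg_shift:
  assumes "x \<in> galg k" "\<tau> \<in> perms k"
  shows "(\<lambda>\<sigma>. x (\<tau> \<circ> \<sigma>)) \<in> galg k"
  unfolding galg_def
proof clarify
  fix \<sigma> assume "x (\<tau> \<circ> \<sigma>) \<noteq> 0"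
  then have "\<tau> \<circ> \<sigma> \<in> perms k" using assms(1) by (simp add: galg_def)
  moreover have "inv \<tau> \<in> perms k" using assms(2) by (simp add: perms_def permutes_inv)
  ultimately have "inv \<tau> \<circ> (\<tau> \<circ> \<sigma>) \<in> perms k" by (rule perms_comp[rotated])
  moreover have "inv \<tau> \<circ> \<tau> = id" using assms(2) by (simp add: perms_def permutes_inv_o)
  ultimately show "\<sigma> \<in> perms k" by (simp add: comp_assoc[symmetric])
qed

lemma gmult_tgen_left:
  assumes "1 \<le> i" "i < k" "x \<in> galg k"
  shows "gmult k (tgen i) x = (\<lambda>\<sigma>. x (transpose i (Suc i) \<circ> \<sigma>))" "gmult k (tgen i) x \<in> galg k"
proof -
  have tr: "transpose i (Suc i) \<in> perms k" using assms by (intro perms_transpose) auto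
  show "gmult k (tgen i) x = (\<lambda>\<sigma>. x (transpose i (Suc i) \<circ> \<sigma>))"
    unfolding tgen_def using gmult_delta_left[OF tr assms(3)] by (simp add: fun_eq_iff)
  with galg_shift[OF assms(3) tr] show "gmult k (tgen i) x \<in> galg k" by simp
qed

lemma gmult_sgen_left:
  assumes "1 \<le> i" "i < k" "x \<in> galg k"
  shows "gmult k (sgen i) x = (\<lambda>\<sigma>. x (transpose i (Suc i) \<circ> \<sigma>) - x \<sigma>)" "gmult k (sgen i) x \<in> galg k"
proof -
  show eq: "gmult k (sgen i) x = (\<lambda>\<sigma>. x (transpose i (Suc i) \<circ> \<sigma>) - x \<sigma>)"
    unfolding sgen_def gmult_diff_left gmult_tgen_left(1)[OF assms]
    using gmult_delta_left[OF perms_id assms(3)] by simp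
  show "gmult k (sgen i) x \<in> galg k"
    unfolding eq using gmult_tgen_left[OF assms] assms(3) by (intro galg_diff) auto
qed

text \<open>\<open>wd f k \<sigma>\<close> is the image of the sorted word under \<open>\<sigma>\<close>, and \<open>proj\<close> is the induced map from the group
  algebra; its kernel is the left ideal that defines \<open>M\<close>.\<close>

definition wd :: "nat \<Rightarrow> nat \<Rightarrow> (nat \<Rightarrow> nat) \<Rightarrow> bool list" where
  "wd f k \<sigma> = map (\<lambda>p. f < inv \<sigma> (Suc p)) [0..<k]"

definition proj :: "nat \<Rightarrow> nat \<Rightarrow> ((nat \<Rightarrow> nat) \<Rightarrow> 'a::field) \<Rightarrow> bool list \<Rightarrow> 'a" where
  "proj f k x w = (\<Sum>\<sigma>\<in>perms k. if wd f k \<sigma> = w then x \<sigma> else 0)"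

lemma wd_id: "wd f (f + g) id = replicate f False @ replicate g True"
  by (rule nth_equalityI) (auto simp: wd_def nth_append)

lemma nth_flip:
  assumes "i + 2 \<le> length w" "p < length w"
  shows "flip i w ! p = w ! transpose i (Suc i) p"
proof -
  obtain w1 a b w2 where w: "w = w1 @ a # b # w2" "length w1 = i"
    using assms(1) by (rule splitE)
  have fl: "flip i w = w1 @ b # a # w2" unfolding w(1) using w(2) flip_append by blast
  consider "p < i" | "p = i" | "p = Suc i" | "Suc (Suc i) \<le> p" by linarith
  then have "(w1 @ b # a # w2) ! p = (w1 @ a # b # w2) ! transpose i (Suc i) p" (is ?P)
  proof cases
    case 4
    then obtain n where "p = Suc (Suc i) + n" using le_Suc_ex by blast
    then show ?P using w(2) by (simp add: nth_append transpose_def)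
  qed (use w(2) in \<open>simp_all add: nth_append transpose_def\<close>)
  then show ?thesis unfolding fl unfolding w(1) .
qed

text \<open>The word is read through the inverse permutation, so left multiplication permutes its
  positions; i - 1 appears because positions start at 0 and generators at 1.\<close>

lemma wd_transpose:
  assumes "1 \<le> i" "i < k" "\<sigma> \<in> perms k"
  shows "wd f k (transpose i (Suc i) \<circ> \<sigma>) = flip (i - 1) (wd f k \<sigma>)"
proof -
  have "bij \<sigma>" using assms by (simp add: perms_def permutes_bij)
  then have inv: "inv (transpose i (Suc i) \<circ> \<sigma>) = inv \<sigma> \<circ> transpose i (Suc i)"
    by (simp add: o_inv_distrib)
  obtain j where i: "i = Suc j" using assms(1) by (cases i) auto
  show ?thesis
  proof (rule nth_equalityI)
    fix p assume "p < length (wd f k (transpose i (Suc i) \<circ> \<sigma>))"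
    then have p: "p < k" by (simp add: wd_def)
    have "transpose j (Suc j) p < k" using p assms(2) i by (simp add: transpose_def)
    moreover have "Suc (transpose j (Suc j) p) = transpose i (Suc i) (Suc p)"
      by (simp add: transpose_def i)
    ultimately show "wd f k (transpose i (Suc i) \<circ> \<sigma>) ! p = flip (i - 1) (wd f k \<sigma>) ! p"
      using p assms(2) i by (simp add: wd_def inv[unfolded i] nth_flip)
  qed (simp add: wd_def)
qed

lemma proj_transpose:
  assumes "1 \<le> i" "i < k"
  shows "proj f k (\<lambda>\<sigma>. x (transpose i (Suc i) \<circ> \<sigma>)) w = proj f k x (flip (i - 1) w)"
proof -
  let ?t = "transpose i (Suc i)"
  have t: "?t \<in> perms k" using assms by (intro perms_transpose) auto
  have tt: "?t \<circ> (?t \<circ> \<sigma>) = \<sigma>" for \<sigma> :: "nat \<Rightarrow> nat"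
    by (simp add: comp_assoc[symmetric] del: o_apply)
  show ?thesis
    unfolding proj_def
  proof (rule sum.reindex_bij_witness[of _ "\<lambda>\<sigma>. ?t \<circ> \<sigma>" "\<lambda>\<sigma>. ?t \<circ> \<sigma>"])
    fix \<sigma> assume s: "\<sigma> \<in> perms k"
    have "wd f k (?t \<circ> \<sigma>) = flip (i - 1) w \<longleftrightarrow> wd f k \<sigma> = w"
      unfolding wd_transpose[OF assms s] by (metis flip_flip)
    then show "(if wd f k (?t \<circ> \<sigma>) = flip (i - 1) w then x (?t \<circ> \<sigma>) else 0) =
        (if wd f k \<sigma> = w then x (?t \<circ> \<sigma>) else 0)" by simp
  qed (use t in \<open>simp_all only: tt perms_comp\<close>)
qed

lemma proj_diff: "proj f k (\<lambda>\<sigma>. x \<sigma> - y \<sigma>) w = proj f k x w - proj f k y w"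
  unfolding proj_def sum_subtractf[symmetric] by (intro sum.cong) auto

lemma proj_sum: "proj f k (\<lambda>\<sigma>. \<Sum>u\<in>U. c u * x u \<sigma>) w = (\<Sum>u\<in>U. c u * proj f k (x u) w)"
proof -
  have "proj f k (\<lambda>\<sigma>. \<Sum>u\<in>U. c u * x u \<sigma>) w =
      (\<Sum>\<sigma>\<in>perms k. \<Sum>u\<in>U. c u * (if wd f k \<sigma> = w then x u \<sigma> else 0))"
    unfolding proj_def by (intro sum.cong) auto
  also have "\<dots> = (\<Sum>u\<in>U. c u * proj f k (x u) w)"
    unfolding proj_def sum_distrib_left by (rule sum.swap)
  finally show ?thesis .
qed

lemma proj_delta_id: "proj f (f + g) (delta id) = single (replicate f False @ replicate g True)"
proof
  fix w
  have "proj f (f + g) (delta id) w = (\<Sum>\<sigma>\<in>perms (f + g). if \<sigma> = id then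
      (if wd f (f + g) id = w then 1 else 0) else 0)"
    unfolding proj_def delta_def by (intro sum.cong) auto
  also have "\<dots> = single (replicate f False @ replicate g True) w"
    by (auto simp: finite_perms perms_id wd_id single_def)
  finally show "proj f (f + g) (delta id) w = single (replicate f False @ replicate g True) w" .
qed

section \<open>The left ideal and the cosets of S_f x S_g\<close>

definition in_ideal :: "nat \<Rightarrow> nat \<Rightarrow> ((nat \<Rightarrow> nat) \<Rightarrow> 'a::field) \<Rightarrow> bool" where
  "in_ideal f g x \<longleftrightarrow> (\<exists>c. (\<forall>i. c i \<in> galg (f + g)) \<and>
     x = (\<lambda>\<sigma>. \<Sum>i\<in>{1..<f+g} - {f}. gmult (f + g) (c i) (sgen i) \<sigma>))"

lemma M_eq_iff: "M_eq f g x y \<longleftrightarrow> in_ideal f g (\<lambda>\<sigma>. x \<sigma> - y \<sigma>)"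
  by (simp add: M_eq_def in_ideal_def)

lemma in_ideal_zero: "in_ideal f g (\<lambda>\<sigma>. 0)"
  unfolding in_ideal_def by (rule exI[of _ "\<lambda>i \<sigma>. 0"]) (simp add: galg_def gmult_zero_left)

lemma in_ideal_add:
  assumes "in_ideal f g x" "in_ideal f g y"
  shows "in_ideal f g (\<lambda>\<sigma>. x \<sigma> + y \<sigma>)"
proof -
  let ?I = "{1..<f+g} - {f}"
  from assms obtain c d where c: "\<forall>i. c i \<in> galg (f + g)" "\<forall>i. d i \<in> galg (f + g)"
    and x: "x = (\<lambda>\<sigma>. \<Sum>i\<in>?I. gmult (f + g) (c i) (sgen i) \<sigma>)"
    and y: "y = (\<lambda>\<sigma>. \<Sum>i\<in>?I. gmult (f + g) (d i) (sgen i) \<sigma>)"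
    unfolding in_ideal_def by blast
  show ?thesis unfolding in_ideal_def
  proof (intro exI conjI)
    show "\<forall>i. (\<lambda>\<sigma>. c i \<sigma> + d i \<sigma>) \<in> galg (f + g)" using c by (simp add: galg_add)
  qed (simp add: x y gmult_add_left sum.distrib)
qed

lemma in_ideal_scale:
  assumes "in_ideal f g x"
  shows "in_ideal f g (\<lambda>\<sigma>. a * x \<sigma>)"
proof -
  let ?I = "{1..<f+g} - {f}"
  from assms obtain c where c: "\<forall>i. c i \<in> galg (f + g)"
    and x: "x = (\<lambda>\<sigma>. \<Sum>i\<in>?I. gmult (f + g) (c i) (sgen i) \<sigma>)"
    unfolding in_ideal_def by blast
  show ?thesis unfolding in_ideal_def
  proof (intro exI conjI)
    show "\<forall>i. (\<lambda>\<sigma>. a * c i \<sigma>) \<in> galg (f + g)" using c by (simp add: galg_scale)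
  qed (simp add: x gmult_scale_left sum_distrib_left)
qed

lemma in_ideal_sum:
  assumes "finite U" "\<And>u. u \<in> U \<Longrightarrow> in_ideal f g (x u)"
  shows "in_ideal f g (\<lambda>\<sigma>. \<Sum>u\<in>U. x u \<sigma>)"
  using assms
proof (induction U rule: finite_induct)
  case empty
  then show ?case by (simp add: in_ideal_zero)
next
  case (insert u U)
  then show ?case using in_ideal_add[of f g "x u" "\<lambda>\<sigma>. \<Sum>u\<in>U. x u \<sigma>"] by simp
qed

text \<open>The type argument fixes the coefficient field, which the two permutations do not
  determine.\<close>

definition coset_equiv :: "'a::field itself \<Rightarrow> nat \<Rightarrow> nat \<Rightarrow> (nat \<Rightarrow> nat) \<Rightarrow> (nat \<Rightarrow> nat) \<Rightarrow> bool" where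
  "coset_equiv _ f g \<sigma> \<tau> \<longleftrightarrow> in_ideal f g (\<lambda>\<rho>. delta \<sigma> \<rho> - delta \<tau> \<rho> :: 'a)"

lemma coset_equiv_refl: "coset_equiv T f g \<sigma> \<sigma>"
  by (simp add: coset_equiv_def in_ideal_zero)

lemma coset_equiv_trans: "coset_equiv T f g \<sigma> \<tau> \<Longrightarrow> coset_equiv T f g \<tau> \<rho> \<Longrightarrow> coset_equiv T f g \<sigma> \<rho>"
  unfolding coset_equiv_def by (drule (1) in_ideal_add) simp

lemma coset_equiv_adjacent:
  assumes \<sigma>: "\<sigma> \<in> perms (f + g)" and i: "1 \<le> i" "i < f + g" "i \<noteq> f"
  shows "coset_equiv (T :: 'a::field itself) f g (\<sigma> \<circ> transpose i (Suc i)) \<sigma>"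
  unfolding coset_equiv_def in_ideal_def
proof (intro exI conjI allI)
  \<comment> \<open>The only nonzero coefficient is \<sigma> at index i, since \<sigma> t_i -
    \<sigma> = \<sigma> s_i.\<close>
  let ?t = "transpose i (Suc i)" and ?c = "\<lambda>l. if l = i then delta \<sigma> else (\<lambda>\<sigma>. 0 :: 'a)"
  show "?c l \<in> galg (f + g)" for l using \<sigma> by (simp add: delta_galg) (simp add: galg_def)
  have bij: "bij \<sigma>" using \<sigma> by (simp add: perms_def permutes_bij)
  have eq: "inv \<sigma> \<circ> \<rho> = \<pi> \<longleftrightarrow> \<rho> = \<sigma> \<circ> \<pi>" for \<rho> \<pi> :: "nat \<Rightarrow> nat"
  proof
    assume "inv \<sigma> \<circ> \<rho> = \<pi>"
    then have "\<sigma> \<circ> \<pi> = (\<sigma> \<circ> inv \<sigma>) \<circ> \<rho>" by (simp add: comp_assoc)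
    then show "\<rho> = \<sigma> \<circ> \<pi>" using bij by (simp add: surj_iff[THEN iffD1] bij_is_surj)
  next
    assume "\<rho> = \<sigma> \<circ> \<pi>"
    then show "inv \<sigma> \<circ> \<rho> = \<pi>" using bij by (simp add: comp_assoc[symmetric] bij_is_inj)
  qed
  have s: "sgen i \<in> galg (f + g)"
    unfolding sgen_def using i by (intro galg_diff tgen_galg delta_galg perms_id) auto
  have "gmult (f + g) (delta \<sigma>) (sgen i) \<rho> = delta (\<sigma> \<circ> ?t) \<rho> - (delta \<sigma> \<rho> :: 'a)" for \<rho>
    unfolding gmult_delta_left[OF \<sigma> s] by (simp add: sgen_def tgen_def delta_def eq)
  then have "gmult (f + g) (?c l) (sgen l) \<rho> =
      (if l = i then delta (\<sigma> \<circ> ?t) \<rho> - delta \<sigma> \<rho> else 0)" for l \<rho>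
    by (simp add: gmult_zero_left)
  then show "(\<lambda>\<rho>. delta (\<sigma> \<circ> ?t) \<rho> - delta \<sigma> \<rho>) =
      (\<lambda>\<rho>. \<Sum>l\<in>{1..<f+g} - {f}. gmult (f + g) (?c l) (sgen l) \<rho>)"
    using i by simp
qed

lemma coset_equiv_transpose:
  assumes "\<sigma> \<in> perms (f + g)" "1 \<le> a" "a < b" "b \<le> f + g" "b \<le> f \<or> f < a"
  shows "coset_equiv T f g (\<sigma> \<circ> transpose a b) \<sigma>"
  using assms(3-5,1)
proof (induction b arbitrary: \<sigma>)
  case (Suc b)
  show ?case
  proof (cases "a = b")
    case True
    then have "1 \<le> b" "b < f + g" "b \<noteq> f" using Suc.prems assms(2) by auto
    then show ?thesis unfolding True by (intro coset_equiv_adjacent Suc.prems(4))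
  next
    case False
    let ?t = "transpose b (Suc b)"
    have ab: "a < b" "1 \<le> b" "b < f + g" "b \<noteq> f" using False Suc.prems assms(2) by auto
    have "?t \<in> perms (f + g)" "transpose a b \<in> perms (f + g)"
      using ab assms(2) by (auto intro: perms_transpose)
    then have mem: "\<sigma> \<circ> ?t \<in> perms (f + g)" "\<sigma> \<circ> ?t \<circ> transpose a b \<in> perms (f + g)"
      using Suc.prems(4) by (auto intro: perms_comp)
    \<comment> \<open>Conjugation by t_b shortens the transposition; as a and b + 1 lie in one
      block, t_b is never t_f.\<close>
    have "transpose a (Suc b) = ?t \<circ> transpose a b \<circ> ?t"
      using ab by (auto simp: fun_eq_iff transpose_def)
    then have "\<sigma> \<circ> transpose a (Suc b) = \<sigma> \<circ> ?t \<circ> transpose a b \<circ> ?t"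
      by (simp add: comp_assoc)
    moreover have "coset_equiv T f g (\<sigma> \<circ> ?t \<circ> transpose a b \<circ> ?t) (\<sigma> \<circ> ?t \<circ> transpose a b)"
      by (rule coset_equiv_adjacent[OF mem(2) ab(2-4)])
    moreover have "coset_equiv T f g (\<sigma> \<circ> ?t \<circ> transpose a b) (\<sigma> \<circ> ?t)"
      by (intro Suc.IH[OF ab(1) _ _ mem(1)]) (use ab Suc.prems(3) in auto)
    moreover have "coset_equiv T f g (\<sigma> \<circ> ?t) \<sigma>"
      by (rule coset_equiv_adjacent[OF Suc.prems(4) ab(2-4)])
    ultimately show ?thesis using coset_equiv_trans by metis
  qed
qed simp

lemma coset_equiv_block:
  assumes "p permutes {a..b}" "\<sigma> \<in> perms (f + g)" "1 \<le> a" "b \<le> f + g" "b \<le> f \<or> f < a"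
  shows "coset_equiv T f g (\<sigma> \<circ> p) \<sigma>"
proof -
  \<comment> \<open>All \<sigma> are treated at once, since splitting a transposition off the left
    of p changes \<sigma>.\<close>
  have "\<forall>\<sigma>\<in>perms (f + g). coset_equiv T f g (\<sigma> \<circ> p) \<sigma>"
    using assms(1) finite_atLeastAtMost
  proof (induction p rule: permutes_induct)
    case (swap x y p)
    show ?case
    proof
      fix \<sigma> assume \<sigma>: "\<sigma> \<in> perms (f + g)"
      have "transpose x y \<in> perms (f + g)"
        using swap.hyps(1,2) assms by (intro perms_transpose) auto
      then have mem: "\<sigma> \<circ> transpose x y \<in> perms (f + g)" using \<sigma> by (intro perms_comp)
      have "coset_equiv T f g (\<sigma> \<circ> transpose x y) \<sigma>"
      proof (cases x y rule: linorder_cases)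
        case less
        then show ?thesis using swap.hyps(1,2) assms by (intro coset_equiv_transpose[OF \<sigma>]) auto
      next
        case equal
        then show ?thesis by (simp add: coset_equiv_refl)
      next
        case greater
        then have "coset_equiv T f g (\<sigma> \<circ> transpose y x) \<sigma>"
          using swap.hyps(1,2) assms by (intro coset_equiv_transpose[OF \<sigma>]) auto
        then show ?thesis by (simp add: transpose_commute)
      qed
      moreover have "coset_equiv T f g (\<sigma> \<circ> transpose x y \<circ> p) (\<sigma> \<circ> transpose x y)"
        using swap.IH mem by blast
      ultimately show "coset_equiv T f g (\<sigma> \<circ> (transpose x y \<circ> p)) \<sigma>"
        unfolding comp_assoc[symmetric] using coset_equiv_trans by blast
    qed
  qed (simp_all add: coset_equiv_refl)
  with assms(2) show ?thesis by blast
qed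

lemma permutes_blockI:
  assumes "\<rho> permutes S" "B \<subseteq> S" "finite S" "\<rho> ` B \<subseteq> B"
  shows "(\<lambda>x. if x \<in> B then \<rho> x else x) permutes B"
proof (rule bij_imp_permutes)
  have "inj_on \<rho> B" using permutes_inj[OF assms(1)] by (rule inj_on_subset) simp
  moreover from this have "\<rho> ` B = B" using assms by (intro endo_inj_surj) (auto intro: finite_subset)
  ultimately have "bij_betw \<rho> B B" by (simp add: bij_betw_def)
  then show "bij_betw (\<lambda>x. if x \<in> B then \<rho> x else x) B B"
    by (rule bij_betw_cong[THEN iffD1, rotated]) simp
qed simp

text \<open>Equal words mean that \<open>inv \<tau> \<circ> \<sigma>\<close> preserves the blocks
  {1..f} and {f+1..f+g}. It therefore factors into a permutation of each block, and either factor
  can be absorbed on the right.\<close>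

lemma coset_equiv_same_word:
  assumes \<sigma>: "\<sigma> \<in> perms (f + g)" and \<tau>: "\<tau> \<in> perms (f + g)" and eq: "wd f (f + g) \<sigma> = wd f (f + g) \<tau>"
  shows "coset_equiv T f g \<sigma> \<tau>"
proof -
  let ?K = "{1..f + g}" and ?A = "{1..f}" and ?B = "{f + 1..f + g}"
  define \<rho> where "\<rho> = inv \<tau> \<circ> \<sigma>"
  have s: "\<sigma> permutes ?K" and t: "\<tau> permutes ?K" using \<sigma> \<tau> by (simp_all add: perms_def)
  have \<rho>: "\<rho> permutes ?K" unfolding \<rho>_def by (intro permutes_compose permutes_inv s t)
  have \<sigma>eq: "\<sigma> = \<tau> \<circ> \<rho>"
    unfolding \<rho>_def by (simp add: comp_assoc[symmetric] permutes_inv_o[OF t])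
  have blk: "f < \<rho> x \<longleftrightarrow> f < x" if "x \<in> ?K" for x
  proof -
    have "\<sigma> x \<in> ?K" using permutes_in_image[OF s] that by blast
    then have "\<sigma> x - 1 < f + g" "Suc (\<sigma> x - 1) = \<sigma> x" by auto
    with arg_cong[OF eq, of "\<lambda>w. w ! (\<sigma> x - 1)"] have "f < inv \<sigma> (\<sigma> x) \<longleftrightarrow> f < inv \<tau> (\<sigma> x)"
      by (simp add: wd_def)
    then show ?thesis by (simp add: \<rho>_def permutes_inverses[OF s])
  qed
  have in_K: "\<rho> x \<in> ?K" if "x \<in> ?K" for x using permutes_in_image[OF \<rho>] that by blast
  define p where "p = (\<lambda>x. if x \<in> ?A then \<rho> x else x)"
  define q where "q = (\<lambda>x. if x \<in> ?B then \<rho> x else x)"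
  have "\<rho> ` ?A \<subseteq> ?A"
  proof clarify
    fix x assume "x \<in> ?A"
    then show "\<rho> x \<in> ?A" using blk[of x] in_K[of x] by auto
  qed
  then have p: "p permutes ?A" unfolding p_def by (intro permutes_blockI[OF \<rho>]) auto
  have "\<rho> ` ?B \<subseteq> ?B"
  proof clarify
    fix x assume "x \<in> ?B"
    then show "\<rho> x \<in> ?B" using blk[of x] in_K[of x] by auto
  qed
  then have q: "q permutes ?B" unfolding q_def by (intro permutes_blockI[OF \<rho>]) auto
  have "\<rho> = p \<circ> q"
  proof
    fix x
    consider "x \<in> ?A" | "x \<in> ?B" | "x \<notin> ?K" by fastforce
    then show "\<rho> x = (p \<circ> q) x"
    proof cases
      case 1
      then show ?thesis by (simp add: p_def q_def)
    next
      case 2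
      then have "\<rho> x \<in> ?B" using \<open>\<rho> ` ?B \<subseteq> ?B\<close> by blast
      with 2 show ?thesis by (simp add: p_def q_def)
    next
      case 3
      then have "\<rho> x = x" using \<rho> by (simp add: permutes_def)
      with 3 show ?thesis by (auto simp: p_def q_def)
    qed
  qed
  then have "\<sigma> = \<tau> \<circ> p \<circ> q" using \<sigma>eq by (simp add: comp_assoc)
  moreover have "p \<in> perms (f + g)" using p by (auto simp: perms_def intro: permutes_subset)
  then have "\<tau> \<circ> p \<in> perms (f + g)" using \<tau> by (intro perms_comp)
  then have "coset_equiv T f g (\<tau> \<circ> p \<circ> q) (\<tau> \<circ> p)" using q by (intro coset_equiv_block) auto
  moreover have "coset_equiv T f g (\<tau> \<circ> p) \<tau>" using p \<tau> by (intro coset_equiv_block) auto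
  ultimately show ?thesis using coset_equiv_trans by metis
qed

text \<open>Replacing each \<sigma> in x by a fixed representative of its word changes x by an
  element of the ideal. After replacement the coefficient of the representative of w is
  \<open>proj\<close> of x at w, which is zero.\<close>

lemma in_ideal_if_proj_zero:
  fixes x :: "(nat \<Rightarrow> nat) \<Rightarrow> 'a::field"
  assumes x: "x \<in> galg (f + g)" and zero: "\<And>w. proj f (f + g) x w = 0"
  shows "in_ideal f g x"
proof -
  let ?P = "perms (f + g)" and ?w = "wd f (f + g)"
  define r where "r w = (SOME \<sigma>. \<sigma> \<in> ?P \<and> ?w \<sigma> = w)" for w
  have r: "r (?w \<sigma>) \<in> ?P \<and> ?w (r (?w \<sigma>)) = ?w \<sigma>" if "\<sigma> \<in> ?P" for \<sigma>
    unfolding r_def by (rule someI[of _ \<sigma>]) (use that in simp)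
  have expand: "x \<rho> = (\<Sum>\<sigma>\<in>?P. x \<sigma> * (delta \<sigma> \<rho> - delta (r (?w \<sigma>)) \<rho>))" for \<rho>
  proof -
    have "(\<Sum>\<sigma>\<in>?P. x \<sigma> * delta (r (?w \<sigma>)) \<rho>) =
        (\<Sum>w\<in>?w ` ?P. \<Sum>\<sigma>\<in>{\<sigma> \<in> ?P. ?w \<sigma> = w}. x \<sigma> * delta (r (?w \<sigma>)) \<rho>)"
      by (rule sum.image_gen[OF finite_perms])
    also have "\<dots> = (\<Sum>w\<in>?w ` ?P. proj f (f + g) x w * delta (r w) \<rho>)"
    proof (rule sum.cong)
      fix w
      have "(\<Sum>\<sigma>\<in>{\<sigma> \<in> ?P. ?w \<sigma> = w}. x \<sigma> * delta (r (?w \<sigma>)) \<rho>) =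
          (\<Sum>\<sigma>\<in>{\<sigma> \<in> ?P. ?w \<sigma> = w}. x \<sigma>) * delta (r w) \<rho>"
        unfolding sum_distrib_right by (rule sum.cong) auto
      also have "(\<Sum>\<sigma>\<in>{\<sigma> \<in> ?P. ?w \<sigma> = w}. x \<sigma>) = proj f (f + g) x w"
        unfolding proj_def by (rule sum.inter_filter[OF finite_perms])
      finally show "(\<Sum>\<sigma>\<in>{\<sigma> \<in> ?P. ?w \<sigma> = w}. x \<sigma> * delta (r (?w \<sigma>)) \<rho>) =
          proj f (f + g) x w * delta (r w) \<rho>" .
    qed simp
    also have "\<dots> = 0" by (simp add: zero)
    finally have "(\<Sum>\<sigma>\<in>?P. x \<sigma> * delta (r (?w \<sigma>)) \<rho>) = 0" .
    moreover have "(\<Sum>\<sigma>\<in>?P. x \<sigma> * delta \<sigma> \<rho>) = (\<Sum>\<sigma>\<in>?P. if \<sigma> = \<rho> then x \<rho> else 0)"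
      by (intro sum.cong) (auto simp: delta_def)
    then have "(\<Sum>\<sigma>\<in>?P. x \<sigma> * delta \<sigma> \<rho>) = x \<rho>"
      using x by (auto simp: finite_perms galg_def)
    ultimately show ?thesis by (simp add: right_diff_distrib sum_subtractf)
  qed
  have "in_ideal f g (\<lambda>\<rho>. \<Sum>\<sigma>\<in>?P. x \<sigma> * (delta \<sigma> \<rho> - delta (r (?w \<sigma>)) \<rho>))"
  proof (intro in_ideal_sum finite_perms in_ideal_scale)
    fix \<sigma> assume "\<sigma> \<in> ?P"
    with r[OF this] have "coset_equiv TYPE('a) f g \<sigma> (r (?w \<sigma>))"
      by (intro coset_equiv_same_word) auto
    then show "in_ideal f g (\<lambda>\<rho>. delta \<sigma> \<rho> - delta (r (?w \<sigma>)) \<rho> :: 'a)"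
      by (simp add: coset_equiv_def)
  qed
  then show ?thesis unfolding expand[symmetric] .
qed

text \<open>All five claims go through one induction: the formula for left multiplication by a
  generator requires the product so far to lie in the group algebra, and the length keeps the index
  of the generator in range.\<close>

lemma gprod_raises:
  assumes "raises is (replicate f False @ replicate g True) u"
  shows "length u = f + g"
    and "(gprod (f + g) (map tgen is) :: _ \<Rightarrow> 'a::field) \<in> galg (f + g)"
    and "(gprod (f + g) (map sgen is) :: _ \<Rightarrow> 'a::field) \<in> galg (f + g)"
    and "proj f (f + g) (gprod (f + g) (map tgen is)) = (single u :: _ \<Rightarrow> 'a::field)"
    and "proj f (f + g) (gprod (f + g) (map sgen is)) = (canonical u :: _ \<Rightarrow> 'a::field)"
proof -
  let ?T = "\<lambda>is. gprod (f + g) (map tgen is) :: _ \<Rightarrow> 'a"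
  let ?S = "\<lambda>is. gprod (f + g) (map sgen is) :: _ \<Rightarrow> 'a"
  have "length u = f + g \<and> ?T is \<in> galg (f + g) \<and> ?S is \<in> galg (f + g) \<and>
      proj f (f + g) (?T is) = single u \<and> proj f (f + g) (?S is) = canonical u"
    using assms
  proof (induction "is" arbitrary: u)
    case Nil
    then have "sorted u" by (auto simp: sorted_append)
    with Nil show ?case
      by (simp add: delta_galg perms_id proj_delta_id canonical_sorted)
  next
    case (Cons i "is")
    then obtain u1 u2 where u': "raises is (replicate f False @ replicate g True) (u1 @ False # True # u2)"
      and i: "i = Suc (length u1)" and u: "u = u1 @ True # False # u2" by auto
    let ?u = "u1 @ False # True # u2"
    from Cons.IH[OF u'] have len: "length ?u = f + g" and gal: "?T is \<in> galg (f + g)" "?S is \<in> galg (f + g)"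
      and T: "proj f (f + g) (?T is) = single ?u" and S: "proj f (f + g) (?S is) = canonical ?u"
      by blast+
    have ik: "1 \<le> i" "i < f + g" using len i by simp_all
    note t = gmult_tgen_left[OF ik gal(1)] and s = gmult_sgen_left[OF ik gal(2)]
    have "proj f (f + g) (?T (i # is)) w = single u w" for w
    proof -
      have "proj f (f + g) (?T (i # is)) w = single ?u (flip (length u1) w)"
        unfolding list.map gprod.simps t(1) proj_transpose[OF ik] T by (simp add: i)
      also have "\<dots> = single u w"
        unfolding single_def u by (metis flip_append flip_flip)
      finally show ?thesis .
    qed
    moreover have "proj f (f + g) (?S (i # is)) w = canonical u w" for w
    proof -
      have "proj f (f + g) (?S (i # is)) w = sact (length u1) (canonical ?u) w"
        unfolding list.map gprod.simps s(1) proj_diff proj_transpose[OF ik] S by (simp add: i sact_def)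
      then show ?thesis by (simp only: sact_canonical u)
    qed
    ultimately show ?case using t(2) s(2) len u by (simp add: fun_eq_iff)
  qed
  then show "length u = f + g" "?T is \<in> galg (f + g)" "?S is \<in> galg (f + g)"
      "proj f (f + g) (?T is) = single u" "proj f (f + g) (?S is) = canonical u"
    by blast+
qed

theorem theorem5p4:
  fixes f g :: nat and mu :: "nat list"
  assumes "mu \<in> Pfg f g"
  shows "M_eq f g (t_part f g mu :: (nat \<Rightarrow> nat) \<Rightarrow> 'a::field)
           (\<lambda>\<sigma>. \<Sum>lam\<in>Pfg f g. of_nat (ici lam mu) * s_part f g lam \<sigma>)"
proof -
  let ?t = "t_part f g mu :: (nat \<Rightarrow> nat) \<Rightarrow> 'a"
  let ?s = "\<lambda>lam. s_part f g lam :: (nat \<Rightarrow> nat) \<Rightarrow> 'a"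
  let ?sum = "\<lambda>\<sigma>. \<Sum>lam\<in>Pfg f g. of_nat (ici lam mu) * ?s lam \<sigma>"
  have "?s lam \<in> galg (f + g)" if "lam \<in> Pfg f g" for lam
    unfolding s_part_def by (rule gprod_raises(3)[OF raises_word[OF that]])
  then have "?sum \<in> galg (f + g)"
    unfolding galg_def by (auto intro!: sum.neutral)
  moreover have "?t \<in> galg (f + g)"
    unfolding t_part_def by (rule gprod_raises(2)[OF raises_word[OF assms]])
  ultimately have "(\<lambda>\<sigma>. ?t \<sigma> - ?sum \<sigma>) \<in> galg (f + g)" by (intro galg_diff)
  \<comment> \<open>It remains to compare both sides as vectors on words, where the claim is
    \<open>single_expansion\<close> for the path of \<open>mu\<close>, reindexed from words to
    partitions.\<close>
  moreover have "proj f (f + g) (\<lambda>\<sigma>. ?t \<sigma> - ?sum \<sigma>) w = 0" for w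
  proof -
    have "proj f (f + g) ?sum w =
        (\<Sum>lam\<in>Pfg f g. of_nat (tiling_number (path f lam) (path f mu)) * canonical (path f lam) w)"
      unfolding proj_sum s_part_def
      by (intro sum.cong)
        (simp_all add: gprod_raises(5)[OF raises_word] ici_eq_tiling_number[OF _ assms])
    also have "\<dots> = (\<Sum>u\<in>words f g. of_nat (tiling_number u (path f mu)) * canonical u w)"
      by (rule sum.reindex_bij_betw[OF bij_betw_path])
    also have "\<dots> = single (path f mu) w"
      by (rule single_expansion[OF path_in_words[OF assms], symmetric])
    also have "\<dots> = proj f (f + g) ?t w"
      unfolding t_part_def by (simp add: gprod_raises(4)[OF raises_word[OF assms]])
    finally show ?thesis unfolding proj_diff by simp
  qed
  ultimately show ?thesis unfolding M_eq_iff by (rule in_ideal_if_proj_zero)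
qed

end
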